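(* Let $n\ge 1$ be an integer, let $\alpha>0$ and $1<q\le 1+\frac{\alpha}{n}$ be real numbers, and let $\mathbb S=(0,+\infty)\times\mathbb R^n$. Let $\mathcal L=\sum_{i,j=1}^n\frac{\partial}{\partial x_i}\left[a_{ij}(t,x)\frac{\partial}{\partial x_j}\right]$, where the $a_{ij}$ are measurable and locally bounded in $\mathbb S$, $a_{ij}=a_{ji}$ a.e. in $\mathbb S$, and $0\le\sum_{i,j=1}^n a_{ij}(t,x)\xi_i\xi_j\le A(t,x)|\xi|^2$ for all $\xi\in\mathbb R^n$ and almost all $(t,x)\in\mathbb S$, with $A$ a measurable, non-negative, locally bounded function in $\mathbb S$. Suppose there is a constant $c>0$ such that $$\operatorname*{ess\,sup}_{(t,x)\in(0,+\infty)\times\{R/2<|x|<R\}}A(t,x)\le cR^{2-\alpha}\quad\text{for all }R>1 .$$ Let $u_0:\mathbb R^n\to\mathbb R$ be arbitrary initial data, and let $u$ be a non-negative entire weak solution of the Cauchy problem, with initial data $u(0,\cdot)=u_0$, for the inequality $u_t\ge\mathcal Lu+|u|^{q-1}u$ in $\mathbb S$. Then $u=0$ (a.e.) in $\mathbb S$.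
   Context: For a bounded domain $\Pi\subset\mathbb S$ and $\hat q=\max\{1,q\}$, $W^{\mathcal L,q}(\Pi)$ denotes the completion of (the functions of finite norm in) $C^\infty(\Pi)$ with respect to the norm $$\|w\|_{W^{\mathcal L,q}(\Pi)}=\int_\Pi|w_t|\,dt\,dx+\left[\int_\Pi\sum_{i,j=1}^n a_{ij}(t,x)\frac{\partial w}{\partial x_i}\frac{\partial w}{\partial x_j}\,dt\,dx\right]^{1/2}+\left[\int_\Pi|w|^{\hat q}\,dt\,dx\right]^{1/\hat q}.$$ A function $w$ belongs to $W^{\mathcal L,q}_{\mathrm{loc}}(\mathbb S)$ if it belongs to $W^{\mathcal L,q}(\Pi)$ for every bounded domain $\Pi\subset\mathbb S$. For elements of the completion, $w_t$ and the expressions $\sum a_{ij}\frac{\partial\varphi}{\partial x_i}\frac{\partial w}{\partial x_j}$, $\sum a_{ij}\frac{\partial w}{\partial x_i}\frac{\partial w}{\partial x_j}$ are understood as limits along approximating sequences of smooth functions. A measurable function $u$ on $\mathbb S$ is an entire weak solution of $u_t\ge\mathcal Lu+|u|^{q-1}u$ in $\mathbb S$ if $u\in W^{\mathcal L,q}_{\mathrm{loc}}(\mathbb S)$ and, for every non-negative $\varphi\in C^\infty(\mathbb S)$ with compact support in $\mathbb S$, $$\int_{\mathbb S}\Big[u_t\varphi+\sum_{i,j=1}^n a_{ij}\frac{\partial\varphi}{\partial x_i}\frac{\partial u}{\partial x_j}-|u|^{q-1}u\,\varphi\Big]dt\,dx\ \ge 0.$$ An entire weak solution of the Cauchy problem with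 initial data $u_0$ is an entire weak solution $u$ in $\mathbb S$ that takes these data at $t=0$, i.e. $u(t,\cdot)\to u_0$ in $L^1_{\mathrm{loc}}(\mathbb R^n)$ as $t\to0^+$. No other condition is imposed on the initial data, and none on the behaviour of solutions at infinity. *)

theory Defs
  imports "HOL-Probability.Essential_Supremum"
begin

type_synonym 'n spacetime = "real \<times> (real, 'n) vec"

definition half_space :: "('n::finite) spacetime set" where
  "half_space = {0<..} \<times> UNIV"

definition bounded_domain :: "('n::finite) spacetime set \<Rightarrow> bool" where
  "bounded_domain \<Omega> \<longleftrightarrow>
     open \<Omega> \<and> connected \<Omega> \<and> bounded \<Omega> \<and> \<Omega> \<noteq> {} \<and> \<Omega> \<subseteq> half_space"

definition locally_bounded_on :: "'a::topological_space set \<Rightarrow> ('a \<Rightarrow> real) \<Rightarrow> bool" where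
  "locally_bounded_on U f \<longleftrightarrow> (\<forall>K. compact K \<and> K \<subseteq> U \<longrightarrow> bounded (f ` K))"

text \<open>\<open>C_k_on k U f\<close>: \<open>f\<close> is \<open>k\<close> times continuously differentiable on the open set \<open>U\<close>,
  in terms of iterated directional derivatives. Values of \<open>f\<close> outside \<open>U\<close> are irrelevant.\<close>

fun C_k_on :: "nat \<Rightarrow> 'a::euclidean_space set \<Rightarrow> ('a \<Rightarrow> real) \<Rightarrow> bool" where
  "C_k_on 0 U f \<longleftrightarrow> continuous_on U f"
| "C_k_on (Suc k) U f \<longleftrightarrow>
     (\<forall>p\<in>U. f differentiable (at p)) \<and>
     (\<forall>v. C_k_on k U (\<lambda>p. frechet_derivative f (at p) v))"

definition smooth_on :: "'a::euclidean_space set \<Rightarrow> ('a \<Rightarrow> real) \<Rightarrow> bool" where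
  "smooth_on U f \<longleftrightarrow> (\<forall>k. C_k_on k U f)"

definition dt :: "(('n::finite) spacetime \<Rightarrow> real) \<Rightarrow> 'n spacetime \<Rightarrow> real" where
  "dt w p = frechet_derivative w (at p) (1, 0)"

definition dx :: "'n \<Rightarrow> (('n::finite) spacetime \<Rightarrow> real) \<Rightarrow> 'n spacetime \<Rightarrow> real" where
  "dx i w p = frechet_derivative w (at p) (0, axis i 1)"

type_synonym 'n coeffs = "'n \<Rightarrow> 'n \<Rightarrow> 'n spacetime \<Rightarrow> real"

definition dirichlet ::
  "('n::finite) coeffs \<Rightarrow> ('n spacetime \<Rightarrow> real) \<Rightarrow> ('n spacetime \<Rightarrow> real) \<Rightarrow> 'n spacetime \<Rightarrow> real"
where
  "dirichlet a v w p = (\<Sum>i\<in>UNIV. \<Sum>j\<in>UNIV. a i j p * dx i v p * dx j w p)"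

definition qhat :: "real \<Rightarrow> real" where
  "qhat q = max 1 q"

definition W_smooth ::
  "('n::finite) coeffs \<Rightarrow> real \<Rightarrow> 'n spacetime set \<Rightarrow> ('n spacetime \<Rightarrow> real) set"
where
  "W_smooth a q \<Omega> = {w. smooth_on \<Omega> w \<and>
     integrable (lebesgue_on \<Omega>) (\<lambda>p. \<bar>dt w p\<bar>) \<and>
     integrable (lebesgue_on \<Omega>) (dirichlet a w w) \<and>
     integrable (lebesgue_on \<Omega>) (\<lambda>p. \<bar>w p\<bar> powr qhat q)}"

definition W_norm ::
  "('n::finite) coeffs \<Rightarrow> real \<Rightarrow> 'n spacetime set \<Rightarrow> ('n spacetime \<Rightarrow> real) \<Rightarrow> real"
where
  "W_norm a q \<Omega> w =
     (LINT p|lebesgue_on \<Omega>. \<bar>dt w p\<bar>)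
     + sqrt (LINT p|lebesgue_on \<Omega>. dirichlet a w w p)
     + (LINT p|lebesgue_on \<Omega>. \<bar>w p\<bar> powr qhat q) powr (1 / qhat q)"

text \<open>An element of the completion is a class of Cauchy sequences in \<open>W_smooth a q \<Omega>\<close>.
  \<open>W_represents a q \<Omega> s w\<close> says that the Cauchy sequence \<open>s\<close> gives such an element whose underlying
  function is \<open>w\<close>, the limit of \<open>s\<close> in \<open>L\<^sup>q\<close> with exponent \<open>qhat q\<close>. A function \<open>w\<close> belongs to the
  completion iff some \<open>s\<close> represents it. Since the quadratic form may degenerate, \<open>w\<close> alone need
  not determine the limits of the gradient expressions, so the sequence is kept.\<close>

definition W_represents ::
  "('n::finite) coeffs \<Rightarrow> real \<Rightarrow> 'n spacetime set \<Rightarrow> (nat \<Rightarrow> 'n spacetime \<Rightarrow> real) \<Rightarrow>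
   ('n spacetime \<Rightarrow> real) \<Rightarrow> bool"
where
  "W_represents a q \<Omega> s w \<longleftrightarrow>
     (\<forall>k. s k \<in> W_smooth a q \<Omega>) \<and>
     (\<forall>e>0. \<exists>N. \<forall>k\<ge>N. \<forall>l\<ge>N. W_norm a q \<Omega> (\<lambda>p. s k p - s l p) < e) \<and>
     w \<in> borel_measurable (lebesgue_on \<Omega>) \<and>
     (\<forall>k. integrable (lebesgue_on \<Omega>) (\<lambda>p. \<bar>s k p - w p\<bar> powr qhat q)) \<and>
     (\<lambda>k. LINT p|lebesgue_on \<Omega>. \<bar>s k p - w p\<bar> powr qhat q) \<longlonglongrightarrow> 0"

text \<open>\<open>w\<close> belongs to the local space iff \<open>W_loc_represents a q \<sigma> w\<close> for some \<open>\<sigma>\<close>.\<close>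

definition W_loc_represents ::
  "('n::finite) coeffs \<Rightarrow> real \<Rightarrow> ('n spacetime set \<Rightarrow> nat \<Rightarrow> 'n spacetime \<Rightarrow> real) \<Rightarrow>
   ('n spacetime \<Rightarrow> real) \<Rightarrow> bool"
where
  "W_loc_represents a q \<sigma> w \<longleftrightarrow>
     (\<forall>\<Omega>. bounded_domain \<Omega> \<longrightarrow> W_represents a q \<Omega> (\<sigma> \<Omega>) w)"

definition L1_limit ::
  "('n::finite) spacetime set \<Rightarrow> (nat \<Rightarrow> 'n spacetime \<Rightarrow> real) \<Rightarrow> ('n spacetime \<Rightarrow> real) \<Rightarrow> bool"
where
  "L1_limit \<Omega> f F \<longleftrightarrow>
     (\<forall>k. integrable (lebesgue_on \<Omega>) (f k)) \<and> integrable (lebesgue_on \<Omega>) F \<and>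
     (\<lambda>k. LINT p|lebesgue_on \<Omega>. \<bar>f k p - F p\<bar>) \<longlonglongrightarrow> 0"

definition test_function :: "(('n::finite) spacetime \<Rightarrow> real) \<Rightarrow> bool" where
  "test_function \<phi> \<longleftrightarrow>
     smooth_on half_space \<phi> \<and> (\<forall>p\<in>half_space. 0 \<le> \<phi> p) \<and>
     (\<exists>K. compact K \<and> K \<subseteq> half_space \<and> (\<forall>p\<in>half_space - K. \<phi> p = 0))"

text \<open>Below, \<open>ut\<close> is the function \<open>u\<^sub>t\<close> and \<open>G\<close> is the function
  \<open>\<Sum>i j. a\<^sub>i\<^sub>j (\<partial>\<phi>/\<partial>x\<^sub>i) (\<partial>u/\<partial>x\<^sub>j)\<close>, both obtained as \<open>L\<^sup>1\<close> limits along the approximating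
  sequences. These limits exist for every test function and are unique up to null sets on each
  bounded domain; requiring one \<open>ut\<close> and one \<open>G\<close> for all bounded domains expresses that the
  elements of the completions over different domains are restrictions of the same object \<open>u\<close>.\<close>

definition entire_weak_solution ::
  "('n::finite) coeffs \<Rightarrow> real \<Rightarrow> ('n spacetime \<Rightarrow> real) \<Rightarrow> bool"
where
  "entire_weak_solution a q u \<longleftrightarrow>
     u \<in> borel_measurable (lebesgue_on half_space) \<and>
     (\<exists>\<sigma> ut. W_loc_represents a q \<sigma> u \<and>
        (\<forall>\<Omega>. bounded_domain \<Omega> \<longrightarrow> L1_limit \<Omega> (\<lambda>k. dt (\<sigma> \<Omega> k)) ut) \<and>
        (\<forall>\<phi>. test_function \<phi> \<longrightarrow>
           (\<exists>G. (\<forall>\<Omega>. bounded_domain \<Omega> \<longrightarrow> L1_limit \<Omega> (\<lambda>k. dirichlet a \<phi> (\<sigma> \<Omega> k)) G) \<and>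
             (LINT p|lebesgue_on half_space.
                ut p * \<phi> p + G p - \<bar>u p\<bar> powr (q - 1) * u p * \<phi> p) \<ge> 0)))"

text \<open>Convergence \<open>u(t,\<cdot>) \<longrightarrow> u\<^sub>0\<close> in \<open>L\<^sup>1\<^sub>l\<^sub>o\<^sub>c\<close> as \<open>t \<longrightarrow> 0+\<close>. Since \<open>u\<close> matters only up to null
  sets, its time slices are considered for almost every \<open>t\<close>.\<close>

definition takes_initial_data ::
  "(('n::finite) spacetime \<Rightarrow> real) \<Rightarrow> ((real, 'n) vec \<Rightarrow> real) \<Rightarrow> bool"
where
  "takes_initial_data u u0 \<longleftrightarrow>
     (\<forall>K. compact K \<longrightarrow>
        integrable (lebesgue_on K) u0 \<and>
        (\<forall>e>0. \<exists>d>0. AE t in lebesgue. 0 < t \<and> t < d \<longrightarrow>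
           integrable (lebesgue_on K) (\<lambda>x. u (t, x)) \<and>
           (LINT x|lebesgue_on K. \<bar>u (t, x) - u0 x\<bar>) < e))"

definition entire_weak_solution_Cauchy ::
  "('n::finite) coeffs \<Rightarrow> real \<Rightarrow> ((real, 'n) vec \<Rightarrow> real) \<Rightarrow> ('n spacetime \<Rightarrow> real) \<Rightarrow> bool"
where
  "entire_weak_solution_Cauchy a q u0 u \<longleftrightarrow>
     entire_weak_solution a q u \<and> takes_initial_data u u0"

end

theory Submission
  imports Defs
begin

text \<open>Let \<open>s\<close> run through the smooth functions approximating \<open>u\<close>. The inequality is tested with
  \<open>\<Psi> (s / \<epsilon>) \<zeta>\<close>, where \<open>\<Psi>\<close> is smooth and decreasing with values in \<open>[1, 2]\<close> and
  \<open>- \<Psi>' s \<ge> const (1 + \<bar>s\<bar>) powr (- 1 - d)\<close> for some \<open>d\<close> with \<open>1 + d < q\<close>, and \<open>\<zeta>\<close> is a high power of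
  a cutoff at the scales \<open>\<bar>x\<bar> \<sim> R\<close>, \<open>t \<sim> R powr \<alpha>\<close> (times a cutoff near \<open>t = 0\<close>, whose time derivative has
  the favourable sign, so that the initial data play no role). The term \<open>\<Psi>' \<zeta> \<Sum> a\<^sub>i\<^sub>j s\<^sub>i s\<^sub>j\<close> absorbs all
  gradients of \<open>s\<close>; what is left is \<open>(1 + \<bar>s\<bar> / \<epsilon>) powr (1 + d)\<close> on the shell where \<open>\<zeta>\<close> varies, with the
  factor \<open>A \<bar>\<nabla>\<zeta>\<bar>\<^sup>2 / \<zeta> \<le> const R powr (- \<alpha>)\<close>. With \<open>\<epsilon> = l R powr (- \<alpha> / (q - 1))\<close> and Young's
  inequality this gives
  \<open>\<integral> u powr q \<zeta> \<le> C (l + l powr (1 - q) \<integral>\<^sub>s\<^sub>h\<^sub>e\<^sub>l\<^sub>l u powr q \<zeta>)\<close> for all \<open>R > 1\<close> and \<open>l > 0\<close>,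
  precisely because \<open>q \<le> 1 + \<alpha> / n\<close>. A large \<open>l\<close> shows that \<open>u powr q\<close> is integrable; then the shell
  integral tends to \<open>0\<close> as \<open>R \<rightarrow> \<infinity>\<close>, and \<open>l \<rightarrow> 0\<close> gives \<open>u = 0\<close>.\<close>

section \<open>Calculus of smooth functions\<close>

text \<open>Since \<open>U\<close> is open, equality on \<open>U\<close> determines the derivatives
  at points of \<open>U\<close>, so the recursion over \<open>k\<close> can pass to them.\<close>

lemma C_k_on_cong:
  assumes "open U" "\<And>p. p \<in> U \<Longrightarrow> f p = g p" "C_k_on k U f"
  shows "C_k_on k U g"
  using assms(2,3)
proof (induction k arbitrary: f g)
  case 0
  then show ?case by (metis C_k_on.simps(1) continuous_on_cong)
next
  case (Suc k)
  have S: "\<And>p. p\<in>U \<Longrightarrow> f differentiable (at p)" "\<And>v. C_k_on k U (\<lambda>p. frechet_derivative f (at p) v)"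
    using Suc.prems(2) unfolding C_k_on.simps by blast+
  have D: "(g has_derivative frechet_derivative f (at p)) (at p)" if "p \<in> U" for p
  proof (rule has_derivative_transform_within_open[OF _ assms(1) that Suc.prems(1)])
    show "(f has_derivative frechet_derivative f (at p)) (at p)"
      using S(1)[OF that] unfolding frechet_derivative_works .
  qed
  have E: "frechet_derivative f (at p) v = frechet_derivative g (at p) v" if "p \<in> U" for p v
    using frechet_derivative_at[OF D[OF that]] by metis
  have "C_k_on k U (\<lambda>p. frechet_derivative g (at p) v)" for v
    by (rule Suc.IH[OF _ S(2)]) (rule E)
  moreover have "g differentiable (at p)" if "p \<in> U" for p
    using D[OF that] unfolding differentiable_def by blast
  ultimately show ?case by simp
qed

text \<open>By uniqueness of the derivative, any explicit \<open>f'\<close> may stand in for the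
  choice term \<open>frechet_derivative\<close> of the definition.\<close>

lemma C_k_on_SucI:
  assumes "open U" "\<And>p. p \<in> U \<Longrightarrow> (f has_derivative f' p) (at p)"
    "\<And>v. C_k_on k U (\<lambda>p. f' p v)"
  shows "C_k_on (Suc k) U f"
proof -
  have "f' p v = frechet_derivative f (at p) v" if "p \<in> U" for p v
    using frechet_derivative_at[OF assms(2)[OF that]] by metis
  then have "C_k_on k U (\<lambda>p. frechet_derivative f (at p) v)" for v
    by (rule C_k_on_cong[OF assms(1) _ assms(3)])
  moreover have "f differentiable (at p)" if "p \<in> U" for p
    using assms(2)[OF that] unfolding differentiable_def by blast
  ultimately show ?thesis by simp
qed

lemma C_k_on_SucD:
  assumes "C_k_on (Suc k) U f"
  shows "p \<in> U \<Longrightarrow> (f has_derivative frechet_derivative f (at p)) (at p)"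
    and "C_k_on k U (\<lambda>p. frechet_derivative f (at p) v)"
  using assms unfolding C_k_on.simps frechet_derivative_works by blast+

lemma C_k_on_le_Suc: "C_k_on (Suc k) U f \<Longrightarrow> C_k_on k U f"
proof (induction k arbitrary: f)
  case 0
  then show ?case
    by (simp add: continuous_at_imp_continuous_on differentiable_imp_continuous_within)
next
  case (Suc k)
  have "C_k_on k U (\<lambda>p. frechet_derivative f (at p) v)" for v
    by (rule Suc.IH) (rule C_k_on_SucD(2)[OF Suc.prems])
  then show ?case using Suc.prems unfolding C_k_on.simps by blast
qed

lemma C_k_on_const: "open U \<Longrightarrow> C_k_on k U (\<lambda>_. c)"
proof (induction k arbitrary: c)
  case (Suc k)
  show ?case
    by (rule C_k_on_SucI[where f' = "\<lambda>_ _. 0"]) (simp_all add: Suc)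
qed simp

lemma C_k_on_bounded_linear:
  assumes "open U" "bounded_linear f"
  shows "C_k_on k U f"
proof (cases k)
  case 0
  then show ?thesis using assms by (simp add: linear_continuous_on)
next
  case (Suc j)
  show ?thesis unfolding Suc
    by (rule C_k_on_SucI[where f' = "\<lambda>_. f"])
      (simp_all add: assms bounded_linear_imp_has_derivative C_k_on_const)
qed

lemma C_k_on_add:
  assumes "open U" "C_k_on k U f" "C_k_on k U g"
  shows "C_k_on k U (\<lambda>p. f p + g p)"
  using assms(2,3)
proof (induction k arbitrary: f g)
  case 0
  then show ?case by (simp add: continuous_on_add)
next
  case (Suc k)
  note f = C_k_on_SucD[OF Suc.prems(1)] and g = C_k_on_SucD[OF Suc.prems(2)]
  show ?case
    by (rule C_k_on_SucI[OF assms(1) has_derivative_add[OF f(1) g(1)] Suc.IH[OF f(2) g(2)]])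
qed

lemma C_k_on_mult:
  assumes "open U" "C_k_on k U f" "C_k_on k U g"
  shows "C_k_on k U (\<lambda>p. f p * g p)"
  using assms(2,3)
proof (induction k arbitrary: f g)
  case 0
  then show ?case by (simp add: continuous_on_mult)
next
  case (Suc k)
  note f = C_k_on_SucD[OF Suc.prems(1)] and g = C_k_on_SucD[OF Suc.prems(2)]
  show ?case
    by (rule C_k_on_SucI[OF assms(1) has_derivative_mult[OF f(1) g(1)]], assumption, assumption)
      (intro C_k_on_add assms(1) Suc.IH f(2) g(2) C_k_on_le_Suc[OF Suc.prems(1)] C_k_on_le_Suc[OF Suc.prems(2)])
qed

text \<open>The outer function comes as the sequence \<open>g\<close> of its successive derivatives,
  so the induction over \<open>k\<close> covers all \<open>g j\<close> at once: the chain rule turns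
  \<open>g j\<close> into \<open>g (Suc j)\<close>. The set \<open>I\<close> admits outer functions
  that are smooth on a part of the line only, such as real powers.\<close>

lemma C_k_on_compose:
  fixes g :: "nat \<Rightarrow> real \<Rightarrow> real"
  assumes "open U" and g: "\<And>j x. x \<in> I \<Longrightarrow> (g j has_real_derivative g (Suc j) x) (at x)"
    and I: "\<And>p. p \<in> U \<Longrightarrow> f p \<in> I" and "C_k_on k U f"
  shows "C_k_on k U (\<lambda>p. g j (f p))"
  using assms(4)
proof (induction k arbitrary: j)
  case 0
  have "isCont (g j) (f p)" if "p \<in> U" for p
    using g[OF I[OF that]] by (rule DERIV_isCont)
  moreover have "isCont f p" if "p \<in> U" for p
    using 0 that assms(1) continuous_on_eq_continuous_at by auto
  ultimately have "isCont (\<lambda>p. g j (f p)) p" if "p \<in> U" for p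
    using that isCont_o2 by blast
  then show ?case by (simp add: continuous_at_imp_continuous_on)
next
  case (Suc k)
  note f = C_k_on_le_Suc[OF Suc.prems] and d = C_k_on_SucD[OF Suc.prems]
  show ?case
  proof (rule C_k_on_SucI[where f' = "\<lambda>p v. g (Suc j) (f p) * frechet_derivative f (at p) v", OF assms(1)])
    show "((\<lambda>p. g j (f p)) has_derivative (\<lambda>v. g (Suc j) (f p) * frechet_derivative f (at p) v)) (at p)"
      if "p \<in> U" for p
      using has_derivative_compose[OF d(1)[OF that], of "g j" "(*) (g (Suc j) (f p))"]
        g[OF I[OF that], of j] by (simp add: has_field_derivative_def)
    show "C_k_on k U (\<lambda>p. g (Suc j) (f p) * frechet_derivative f (at p) v)" for v
      by (intro C_k_on_mult assms(1) Suc.IH f d(2))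
  qed
qed

text \<open>Differentiability is local. This serves to extend functions by zero: one of the two open
  sets is then the complement of a compact support.\<close>

lemma C_k_on_Un: "open U \<Longrightarrow> open V \<Longrightarrow> C_k_on k U f \<Longrightarrow> C_k_on k V f \<Longrightarrow> C_k_on k (U \<union> V) f"
  by (induction k arbitrary: f) (auto intro: continuous_on_open_Un)

lemma C_k_on_subset: "C_k_on k U f \<Longrightarrow> V \<subseteq> U \<Longrightarrow> C_k_on k V f"
  by (induction k arbitrary: f) (auto intro: continuous_on_subset)

section \<open>The same calculus for infinitely differentiable functions\<close>

lemma smooth_on_const: "open U \<Longrightarrow> smooth_on U (\<lambda>_. c)"
  by (simp add: smooth_on_def C_k_on_const)

lemma smooth_on_bounded_linear: "open U \<Longrightarrow> bounded_linear f \<Longrightarrow> smooth_on U f"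
  by (simp add: smooth_on_def C_k_on_bounded_linear)

lemma smooth_on_add: "open U \<Longrightarrow> smooth_on U f \<Longrightarrow> smooth_on U g \<Longrightarrow> smooth_on U (\<lambda>p. f p + g p)"
  by (simp add: smooth_on_def C_k_on_add)

lemma smooth_on_mult: "open U \<Longrightarrow> smooth_on U f \<Longrightarrow> smooth_on U g \<Longrightarrow> smooth_on U (\<lambda>p. f p * g p)"
  by (simp add: smooth_on_def C_k_on_mult)

lemma smooth_on_Un: "open U \<Longrightarrow> open V \<Longrightarrow> smooth_on U f \<Longrightarrow> smooth_on V f \<Longrightarrow> smooth_on (U \<union> V) f"
  by (simp add: smooth_on_def C_k_on_Un)

lemma smooth_on_subset: "smooth_on U f \<Longrightarrow> V \<subseteq> U \<Longrightarrow> smooth_on V f"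
  unfolding smooth_on_def using C_k_on_subset by blast

lemma smooth_on_cong:
  assumes "open U" "\<And>p. p \<in> U \<Longrightarrow> f p = g p" "smooth_on U f"
  shows "smooth_on U g"
  unfolding smooth_on_def
proof
  fix k show "C_k_on k U g"
    by (rule C_k_on_cong[OF assms(1,2)]) (use assms(3) smooth_on_def in auto)
qed

lemma smooth_on_compose:
  fixes g :: "nat \<Rightarrow> real \<Rightarrow> real"
  assumes "open U" "\<And>j x. x \<in> I \<Longrightarrow> (g j has_real_derivative g (Suc j) x) (at x)"
    "\<And>p. p \<in> U \<Longrightarrow> f p \<in> I" "smooth_on U f"
  shows "smooth_on U (\<lambda>p. g j (f p))"
  unfolding smooth_on_def
proof
  fix k show "C_k_on k U (\<lambda>p. g j (f p))"
    by (rule C_k_on_compose[where I = I and g = g, OF assms(1,2,3)]) (use assms(4) smooth_on_def in auto)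
qed

lemma smooth_on_diff:
  "open U \<Longrightarrow> smooth_on U f \<Longrightarrow> smooth_on U g \<Longrightarrow> smooth_on U (\<lambda>p. f p - g p)"
  using smooth_on_add[of U f "\<lambda>p. -1 * g p"] smooth_on_mult[of U "\<lambda>_. -1" g] smooth_on_const[of U "-1"]
  by simp

lemma smooth_on_power:
  "open U \<Longrightarrow> smooth_on U f \<Longrightarrow> smooth_on U (\<lambda>p. f p ^ m)"
  by (induction m) (simp_all add: smooth_on_const smooth_on_mult)

lemma smooth_on_powr:
  fixes r :: real
  assumes "open U" "smooth_on U f" "\<And>p. p \<in> U \<Longrightarrow> 0 < f p"
  shows "smooth_on U (\<lambda>p. f p powr r)"
proof -
  \<comment> \<open>\<open>g j\<close> is the \<open>j\<close>-th derivative of the power, a falling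
    factorial times \<open>x powr (r - j)\<close>; the empty product at \<open>j = 0\<close> gives
    back the power itself.\<close>
  define g where "g j x = (\<Prod>i<j. r - real i) * x powr (r - real j)" for j and x :: real
  have "(g j has_real_derivative g (Suc j) x) (at x)" if "x \<in> {0<..}" for j x
    unfolding g_def using that
    by (auto intro!: derivative_eq_intros simp: algebra_simps)
  from smooth_on_compose[of U "{0<..}" g f 0, OF assms(1) this] assms show ?thesis
    by (simp add: g_def)
qed

lemma smooth_on_has_derivative:
  assumes "smooth_on U f" "p \<in> U"
  shows "(f has_derivative frechet_derivative f (at p)) (at p)"
proof (rule C_k_on_SucD(1)[OF _ assms(2)])
  show "C_k_on (Suc 0) U f" using assms(1) unfolding smooth_on_def by blast
qed

lemma smooth_on_continuous_frechet:
  assumes "smooth_on U f"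
  shows "continuous_on U (\<lambda>p. frechet_derivative f (at p) v)"
proof -
  have "C_k_on (Suc 0) U f" using assms unfolding smooth_on_def by blast
  from C_k_on_SucD(2)[OF this] show ?thesis by simp
qed

lemma smooth_on_continuous:
  assumes "smooth_on U f" shows "continuous_on U f"
proof -
  have "C_k_on 0 U f" using assms unfolding smooth_on_def by blast
  then show ?thesis by simp
qed

section \<open>A smooth step function\<close>

lemma tendsto_poly_times_exp_minus:
  fixes p :: "real poly"
  shows "((\<lambda>y. poly p y * exp (- y)) \<longlongrightarrow> 0) at_top"
proof -
  have "((\<lambda>y. coeff p i * (y ^ i / exp y)) \<longlongrightarrow> 0) at_top" for i
    using tendsto_mult_right_zero[OF tendsto_power_div_exp_0] by blast
  then have "((\<lambda>y. \<Sum>i\<le>degree p. coeff p i * (y ^ i / exp y)) \<longlongrightarrow> 0) at_top"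
    by (intro tendsto_null_sum)
  then show ?thesis
    by (simp add: poly_altdef exp_minus divide_inverse sum_distrib_right mult.assoc)
qed

text \<open>\<open>flat_poly j (1/x) exp (-1/x)\<close> is the \<open>j\<close>-th derivative of \<open>exp (-1/x)\<close> at \<open>x > 0\<close>.\<close>

primrec flat_poly :: "nat \<Rightarrow> real poly" where
  "flat_poly 0 = 1"
| "flat_poly (Suc j) = monom 1 2 * (flat_poly j - pderiv (flat_poly j))"

definition flat :: "nat \<Rightarrow> real \<Rightarrow> real" where
  "flat j x = (if x \<le> 0 then 0 else poly (flat_poly j) (inverse x) * exp (- inverse x))"

text \<open>Away from 0 this is the recursion for \<open>flat_poly\<close>. At 0 the difference
  quotient vanishes from the left; from the right it is a polynomial in \<open>1/y\<close> times
  \<open>exp (-1/y)\<close>, and the exponential wins.\<close>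

lemma DERIV_flat: "(flat j has_real_derivative flat (Suc j) x) (at x)"
proof -
  consider "x < 0" | "x > 0" | "x = 0" by linarith
  then show ?thesis
  proof cases
    case 1
    have "((\<lambda>_. 0) has_real_derivative 0) (at x)" by simp
    then show ?thesis
      by (rule DERIV_cong[OF has_field_derivative_transform_within_open[where S = "{..<0}"]])
        (use 1 in \<open>auto simp: flat_def\<close>)
  next
    case 2
    have "((\<lambda>x. poly (flat_poly j) (inverse x) * exp (- inverse x)) has_real_derivative flat (Suc j) x) (at x)"
      using 2 by (auto intro!: derivative_eq_intros DERIV_chain2[OF poly_DERIV]
        simp: flat_def poly_monom field_simps power2_eq_square)
    then show ?thesis
      by (rule has_field_derivative_transform_within_open[where S = "{0<..}"])
        (use 2 in \<open>auto simp: flat_def\<close>)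
  next
    case 3
    have "((\<lambda>y. (flat j y - flat j 0) / (y - 0)) \<longlongrightarrow> 0) (at 0)"
    proof (rule filterlim_split_at)
      show "((\<lambda>y. (flat j y - flat j 0) / (y - 0)) \<longlongrightarrow> 0) (at_left 0)"
        by (rule tendsto_eventually) (auto simp: eventually_at_filter flat_def)
      \<comment> \<open>Division by \<open>y\<close> multiplies the polynomial in \<open>1/y\<close>
        by one further factor \<open>1/y\<close>, whence \<open>monom 1 1\<close>.\<close>
      have "((\<lambda>x. poly (monom 1 1 * flat_poly j) (inverse x) * exp (- inverse x)) \<longlongrightarrow> 0) (at_right 0)"
        by (rule filterlim_compose[OF tendsto_poly_times_exp_minus filterlim_inverse_at_top_right])
      then show "((\<lambda>y. (flat j y - flat j 0) / (y - 0)) \<longlongrightarrow> 0) (at_right 0)"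
        by (rule Lim_transform_eventually)
          (auto simp: eventually_at_filter flat_def poly_monom field_simps)
    qed
    then show ?thesis using 3 by (simp add: has_field_derivative_iff flat_def)
  qed
qed

lemma flat_0: "flat 0 x = (if x \<le> 0 then 0 else exp (- inverse x))"
  by (simp add: flat_def)

lemma continuous_flat: "isCont (flat j) x"
  by (rule DERIV_isCont[OF DERIV_flat])

text \<open>A smooth cutoff made by composing \<open>flat 0\<close> with itself: the inner
  difference equals \<open>flat 0 1\<close> for \<open>x \<le> 0\<close>, decreases, and is not
  positive from \<open>x = 1\<close> on, where the outer \<open>flat 0\<close> cuts it to 0. The
  denominator normalises the plateau to 1.\<close>

definition step :: "real \<Rightarrow> real" where
  "step x = flat 0 (flat 0 1 - flat 0 x) / flat 0 (flat 0 1)"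

definition step' :: "real \<Rightarrow> real" where
  "step' x = - flat 1 (flat 0 1 - flat 0 x) * flat 1 x / flat 0 (flat 0 1)"

lemma flat_0_mono: "x \<le> y \<Longrightarrow> flat 0 x \<le> flat 0 y"
  by (auto simp: flat_0)

lemma flat_0_nonneg: "0 \<le> flat 0 x" by (simp add: flat_0)

lemma flat_1_nonneg: "0 \<le> flat 1 x"
  by (simp add: flat_def poly_monom)

lemma flat_0_pos: "0 < flat 0 (flat 0 1)" by (simp add: flat_0)

lemma step_nonneg: "0 \<le> step x"
  using flat_0_nonneg flat_0_pos by (simp add: step_def)

lemma step_le_1: "step x \<le> 1"
  using flat_0_mono[of "flat 0 1 - flat 0 x" "flat 0 1"] flat_0_nonneg flat_0_pos by (simp add: step_def)

lemma step_eq_1: "x \<le> 0 \<Longrightarrow> step x = 1"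
  using flat_0_pos by (simp add: step_def flat_0)

lemma step_eq_0: "x \<ge> 1 \<Longrightarrow> step x = 0"
  using flat_0_mono[of 1 x] by (simp add: step_def) (simp add: flat_0)

lemma step'_nonpos: "step' x \<le> 0"
  using flat_1_nonneg flat_0_nonneg by (simp add: step'_def)

lemma step'_eq_0: "x \<le> 0 \<or> x \<ge> 1 \<Longrightarrow> step' x = 0"
  using flat_0_mono[of 1 x] by (auto simp: step'_def) (auto simp: flat_def)

lemma DERIV_step: "(step has_real_derivative step' x) (at x)"
  unfolding step_def[abs_def] step'_def
  using flat_0_pos
  by (auto intro!: derivative_eq_intros DERIV_chain2[OF DERIV_flat] DERIV_flat simp: field_simps)

lemma step'_bounded: obtains B where "B > 0" "\<And>x. \<bar>step' x\<bar> \<le> B"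
proof -
  have "continuous_on {0..1} step'"
    unfolding step'_def[abs_def] using flat_0_pos
    by (intro continuous_at_imp_continuous_on ballI continuous_intros isCont_o2[OF _ continuous_flat]
        continuous_flat) auto
  then have "bounded (step' ` {0..1})"
    by (intro compact_imp_bounded compact_continuous_image) auto
  then obtain B where B: "B > 0" "\<And>x. x \<in> {0..1} \<Longrightarrow> \<bar>step' x\<bar> \<le> B"
    unfolding bounded_pos by auto
  have "\<bar>step' x\<bar> \<le> B" for x
    using B step'_eq_0[of x] by (cases "x \<in> {0..1}") auto
  then show ?thesis using B that by blast
qed

lemma smooth_on_step:
  assumes "open U" "smooth_on U f" shows "smooth_on U (\<lambda>p. step (f p))"
proof -
  have "smooth_on U (\<lambda>p. flat 0 (f p))" if "smooth_on U f" for f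
    by (rule smooth_on_compose[of U UNIV flat, OF assms(1) DERIV_flat _ that]) auto
  then have "smooth_on U (\<lambda>p. flat 0 (flat 0 1 - flat 0 (f p)))"
    by (simp add: smooth_on_diff smooth_on_const assms)
  then have "smooth_on U (\<lambda>p. inverse (flat 0 (flat 0 1)) * flat 0 (flat 0 1 - flat 0 (f p)))"
    by (simp add: smooth_on_mult smooth_on_const assms(1))
  then show ?thesis by (simp add: step_def divide_inverse mult.commute)
qed

section \<open>The nonlinear weight\<close>

text \<open>A smooth positive function that grows like \<open>2 * s\<close> at plus infinity and
  decays like \<open>1 / (2 * \<bar>s\<bar>)\<close> at minus infinity.\<close>

definition exp_arsinh :: "real \<Rightarrow> real" where
  "exp_arsinh s = s + sqrt (1 + s\<^sup>2)"

text \<open>1 plus the logistic function at \<open>- d * arsinh (s / e)\<close>. As arsinh grows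
  only logarithmically, the derivative decays like a power of \<open>\<bar>s\<bar>\<close> and not
  exponentially.\<close>

definition psi :: "real \<Rightarrow> real \<Rightarrow> real \<Rightarrow> real" where
  "psi d e s = 1 + 1 / (1 + exp_arsinh (s / e) powr d)"

definition psi' :: "real \<Rightarrow> real \<Rightarrow> real \<Rightarrow> real" where
  "psi' d e s = - (d * exp_arsinh (s / e) powr d / ((1 + exp_arsinh (s / e) powr d)\<^sup>2 * sqrt (1 + (s / e)\<^sup>2) * e))"

lemma abs_less_sqrt: "\<bar>s\<bar> < sqrt (1 + s\<^sup>2)" for s :: real
  by (rule real_less_rsqrt) simp

lemma exp_arsinh_pos: "0 < exp_arsinh s"
  using abs_less_sqrt[of s] by (simp add: exp_arsinh_def)

lemma exp_arsinh_minus: "exp_arsinh s * exp_arsinh (- s) = 1"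
  by (simp add: exp_arsinh_def algebra_simps power2_eq_square flip: real_sqrt_mult)

lemma exp_arsinh_le: "exp_arsinh s \<le> 2 * (1 + \<bar>s\<bar>)"
proof -
  have "sqrt (1 + s\<^sup>2) \<le> 1 + \<bar>s\<bar>"
    by (rule real_le_lsqrt) (auto simp: power2_eq_square algebra_simps)
  then show ?thesis by (simp add: exp_arsinh_def)
qed

lemma DERIV_exp_arsinh: "(exp_arsinh has_real_derivative exp_arsinh s / sqrt (1 + s\<^sup>2)) (at s)"
proof -
  have "0 < 1 + s\<^sup>2" by (simp add: add_pos_nonneg)
  then show ?thesis
    unfolding exp_arsinh_def[abs_def]
    by (auto intro!: derivative_eq_intros simp: field_simps)
qed

lemma psi_bounds: "1 \<le> psi d e s" "psi d e s \<le> 2"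
proof -
  have "1 / (1 + X) \<le> 1" if "0 \<le> X" for X :: real using that by (simp add: divide_simps)
  from this[of "exp_arsinh (s / e) powr d"] show "1 \<le> psi d e s" "psi d e s \<le> 2"
    by (simp_all add: psi_def)
qed

lemma DERIV_psi:
  assumes "e > 0"
  shows "(psi d e has_real_derivative psi' d e s) (at s)"
proof -
  define h where "h = exp_arsinh (s / e)"
  have h: "0 < h" "1 + h powr d > 0" and r: "0 < sqrt (1 + (s / e)\<^sup>2)"
    unfolding h_def by (simp_all add: exp_arsinh_pos add_pos_nonneg)
  have "((\<lambda>s. exp_arsinh (s / e)) has_real_derivative (h / sqrt (1 + (s / e)\<^sup>2)) * (1 / e)) (at s)"
    unfolding h_def by (rule DERIV_chain2[OF DERIV_exp_arsinh DERIV_cdivide[OF DERIV_ident]])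
  then have "((\<lambda>s. exp_arsinh (s / e) powr d) has_real_derivative d * h powr (d - 1) * ((h / sqrt (1 + (s / e)\<^sup>2)) * (1 / e))) (at s)"
    unfolding h_def by (rule DERIV_chain2[where f = "\<lambda>z. z powr d" and g = "\<lambda>s. exp_arsinh (s / e)", OF has_real_derivative_powr[OF exp_arsinh_pos]])
  then have "(psi d e has_real_derivative - (d * h powr (d - 1) * ((h / sqrt (1 + (s / e)\<^sup>2)) * (1 / e))) / (1 + h powr d)\<^sup>2) (at s)"
    unfolding psi_def[abs_def]
    by (rule DERIV_cong[OF DERIV_add[OF DERIV_const DERIV_divide[OF DERIV_const DERIV_add[OF DERIV_const]]]])
      (use h in \<open>auto simp: h_def power2_eq_square\<close>)
  moreover have "h powr (d - 1) * h = h powr d"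
    using h by (simp add: powr_diff)
  then have "- (d * h powr (d - 1) * ((h / sqrt (1 + (s / e)\<^sup>2)) * (1 / e))) / (1 + h powr d)\<^sup>2 = psi' d e s"
    using h r assms unfolding psi'_def h_def[symmetric] by (simp add: field_simps)
  ultimately show ?thesis by simp
qed

lemma psi'_neg:
  assumes "d > 0" "e > 0" shows "psi' d e s < 0"
proof -
  have "0 < exp_arsinh (s / e) powr d" "0 < 1 + exp_arsinh (s / e) powr d" "0 < sqrt (1 + (s / e)\<^sup>2)"
    using exp_arsinh_pos[of "s / e"] by (simp_all add: add_pos_nonneg)
  then have "0 < d * exp_arsinh (s / e) powr d / ((1 + exp_arsinh (s / e) powr d)\<^sup>2 * sqrt (1 + (s / e)\<^sup>2) * e)"
    using assms by (intro divide_pos_pos mult_pos_pos zero_less_power)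
  then show ?thesis by (simp add: psi'_def)
qed

text \<open>From \<open>X \<le> (1 + X)\<^sup>2\<close> for \<open>X > 0\<close>. This keeps the
  Dirichlet energy of \<open>psi d e (s k) * z\<close> under control by that of \<open>s k\<close>,
  uniformly in \<open>k\<close>.\<close>

lemma psi'_abs_le:
  assumes "d > 0" "e > 0" shows "\<bar>psi' d e s\<bar> \<le> d / e"
proof -
  define X where "X = exp_arsinh (s / e) powr d"
  have X: "0 < X" using exp_arsinh_pos[of "s / e"] by (simp add: X_def)
  have r: "1 \<le> sqrt (1 + (s / e)\<^sup>2)" by simp
  have "X * 1 \<le> (1 + X)\<^sup>2 * sqrt (1 + (s / e)\<^sup>2)"
    by (rule mult_mono) (use X r in \<open>auto simp: power2_eq_square algebra_simps\<close>)
  then have "X / ((1 + X)\<^sup>2 * sqrt (1 + (s / e)\<^sup>2)) \<le> 1" using X r by (simp add: divide_simps)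
  then have "d / e * (X / ((1 + X)\<^sup>2 * sqrt (1 + (s / e)\<^sup>2))) \<le> d / e * 1"
    using assms by (intro mult_left_mono) auto
  moreover have "\<bar>psi' d e s\<bar> = d / e * (X / ((1 + X)\<^sup>2 * sqrt (1 + (s / e)\<^sup>2)))"
    using abs_of_neg[OF psi'_neg[OF assms, of s]] by (simp add: psi'_def X_def mult_ac)
  ultimately show ?thesis by simp
qed

text \<open>Apart from the factor \<open>sqrt (1 + (s / e)\<^sup>2) * e / d\<close>, the left side
  is \<open>(1 + X)\<^sup>2 / X\<close>. Both \<open>X\<close> and \<open>1 / X\<close>, the latter
  being the same power at \<open>- s\<close>, are at most \<open>Y\<close>, so this quotient is at
  most \<open>4 * Y\<close>. Young's inequality later divides by \<open>- psi'\<close>; the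
  resulting power \<open>1 + d\<close> has to stay below \<open>q\<close>.\<close>

lemma inverse_psi'_le:
  assumes "d > 0" "e > 0"
  shows "1 / (- psi' d e s) \<le> 4 * 2 powr d / d * e * (1 + \<bar>s\<bar> / e) powr (1 + d)"
proof -
  define X where "X = exp_arsinh (s / e) powr d"
  define r where "r = 1 + \<bar>s / e\<bar>"
  define Y where "Y = (2 * r) powr d"
  have r1: "1 \<le> r" by (simp add: r_def)
  have X: "0 < X" using exp_arsinh_pos[of "s / e"] by (simp add: X_def)
  have XY: "X \<le> Y" unfolding X_def Y_def r_def
    by (rule powr_mono2) (use assms exp_arsinh_pos[of "s / e"] exp_arsinh_le[of "s / e"] in auto)
  have "exp_arsinh (- (s / e)) powr d \<le> Y" unfolding Y_def r_def
    by (rule powr_mono2) (use assms exp_arsinh_pos[of "- (s / e)"] exp_arsinh_le[of "- (s / e)"] in auto)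
  moreover have "X * exp_arsinh (- (s / e)) powr d = 1" unfolding X_def
    using exp_arsinh_pos[of "s / e"] exp_arsinh_pos[of "- (s / e)"] by (simp add: exp_arsinh_minus flip: powr_mult)
  ultimately have one: "1 \<le> X * Y" using X by (metis mult_left_mono less_imp_le)
  have "1 \<le> Y" unfolding Y_def by (rule ge_one_powr_ge_zero) (use r1 assms in auto)
  then have "X \<le> X * Y" "X * X \<le> X * Y" using X XY by auto
  then have "(1 + X)\<^sup>2 \<le> 4 * (X * Y)"
    using one by (simp add: power2_eq_square algebra_simps)
  moreover have "sqrt (1 + (s / e)\<^sup>2) \<le> r" unfolding r_def
    by (rule real_le_lsqrt) (auto simp: power2_eq_square algebra_simps)
  ultimately have "(1 + X)\<^sup>2 * sqrt (1 + (s / e)\<^sup>2) * e \<le> 4 * (X * Y) * r * e"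
    using assms X \<open>1 \<le> Y\<close> by (intro mult_right_mono mult_mono) auto
  then have "(1 + X)\<^sup>2 * sqrt (1 + (s / e)\<^sup>2) * e / (d * X) \<le> 4 * (X * Y) * r * e / (d * X)"
    using assms X by (intro divide_right_mono) auto
  moreover have "1 / (- psi' d e s) = (1 + X)\<^sup>2 * sqrt (1 + (s / e)\<^sup>2) * e / (d * X)"
    by (simp add: psi'_def X_def)
  moreover have "4 * (X * Y) * r * e / (d * X) = 4 * 2 powr d / d * e * r powr (1 + d)"
    using X r1 by (simp add: Y_def powr_mult powr_add)
  ultimately show ?thesis using assms by (simp add: r_def)
qed

lemma smooth_on_psi:
  assumes U: "open U" and f: "smooth_on U f"
  shows "smooth_on U (\<lambda>p. psi d e (f p))"
proof -
  have 1: "smooth_on U (\<lambda>p. f p / e)"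
    using smooth_on_mult[OF U f smooth_on_const[OF U, of "inverse e"]] by (simp add: divide_inverse)
  have 2: "smooth_on U (\<lambda>p. 1 + (f p / e)\<^sup>2)"
    by (rule smooth_on_add[OF U smooth_on_const[OF U] smooth_on_power[OF U 1]])
  have 3: "smooth_on U (\<lambda>p. (1 + (f p / e)\<^sup>2) powr (1/2))"
    by (rule smooth_on_powr[OF U 2]) (simp add: add_pos_nonneg)
  have 4: "smooth_on U (\<lambda>p. exp_arsinh (f p / e))"
    using smooth_on_add[OF U 1 3] by (simp add: exp_arsinh_def powr_half_sqrt)
  have 5: "smooth_on U (\<lambda>p. 1 + exp_arsinh (f p / e) powr d)"
    by (rule smooth_on_add[OF U smooth_on_const[OF U] smooth_on_powr[OF U 4 exp_arsinh_pos]])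
  have 6: "smooth_on U (\<lambda>p. (1 + exp_arsinh (f p / e) powr d) powr (-1))"
    by (rule smooth_on_powr[OF U 5]) (simp add: add_pos_nonneg)
  show ?thesis
    using smooth_on_add[OF U smooth_on_const[OF U, of 1] 6]
    by (simp add: psi_def powr_minus_divide add_pos_nonneg)
qed

text \<open>Applied to \<open>psi d e\<close>, this gives the primitive \<open>F\<close> for which
  \<open>psi d e s\<close> times the time derivative of \<open>s\<close> is an exact time
  derivative.\<close>

lemma antiderivative_UNIV:
  fixes f :: "real \<Rightarrow> real"
  assumes "\<And>x. isCont f x"
  obtains F where "\<And>x. (F has_real_derivative f x) (at x)" "F 0 = 0"
proof -
  obtain F where F: "\<And>x. (F has_vector_derivative f x) (at x)"
    using einterval_antiderivative[of "-\<infinity>" "\<infinity>" f] assms by auto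
  have "((\<lambda>x. F x - F 0) has_real_derivative f x) (at x)" for x
    using DERIV_diff[OF F[of x, folded has_real_derivative_iff_has_vector_derivative] DERIV_const] by simp
  then show ?thesis using that[of "\<lambda>x. F x - F 0"] by simp
qed

section \<open>The quadratic form\<close>

definition grad :: "(('n::finite) spacetime \<Rightarrow> real) \<Rightarrow> 'n spacetime \<Rightarrow> real ^ 'n" where
  "grad w p = (\<chi> i. dx i w p)"

text \<open>The form on arbitrary vectors, so that Young's inequality is pure algebra at a point,
  separate from differentiation.\<close>

definition qform :: "('n::finite) coeffs \<Rightarrow> 'n spacetime \<Rightarrow> real ^ 'n \<Rightarrow> real ^ 'n \<Rightarrow> real" where
  "qform a p v w = (\<Sum>i\<in>UNIV. \<Sum>j\<in>UNIV. a i j p * v $ i * w $ j)"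

lemma dirichlet_eq_qform: "dirichlet a v w p = qform a p (grad v p) (grad w p)"
  by (simp add: dirichlet_def qform_def grad_def)

lemma qform_add_left: "qform a p (v + v') w = qform a p v w + qform a p v' w"
  and qform_add_right: "qform a p w (v + v') = qform a p w v + qform a p w v'"
  and qform_diff_left: "qform a p (v - v') w = qform a p v w - qform a p v' w"
  and qform_diff_right: "qform a p w (v - v') = qform a p w v - qform a p w v'"
  and qform_scaleR_left: "qform a p (c *\<^sub>R v) w = c * qform a p v w"
  and qform_scaleR_right: "qform a p w (c *\<^sub>R v) = c * qform a p w v"
  by (simp_all add: qform_def sum.distrib sum_subtractf sum_distrib_left algebra_simps)

lemmas qform_bilinear = qform_add_left qform_add_right qform_diff_left qform_diff_right
  qform_scaleR_left qform_scaleR_right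

lemma qform_zero: "qform a p 0 w = 0" "qform a p w 0 = 0"
  by (simp_all add: qform_def)

text \<open>Collects the almost-everywhere hypotheses at one point, so that a single null set serves
  all vectors.\<close>

definition elliptic_at :: "('n::finite) coeffs \<Rightarrow> ('n spacetime \<Rightarrow> real) \<Rightarrow> 'n spacetime \<Rightarrow> bool" where
  "elliptic_at a A p \<longleftrightarrow> (\<forall>i j. a i j p = a j i p) \<and>
     (\<forall>v. 0 \<le> qform a p v v \<and> qform a p v v \<le> A p * (norm v)\<^sup>2)"

lemma elliptic_atD:
  assumes "elliptic_at a A p"
  shows "qform a p v w = qform a p w v" "0 \<le> qform a p v v" "qform a p v v \<le> A p * (norm v)\<^sup>2"
proof -
  have "a i j p = a j i p" for i j using assms by (simp add: elliptic_at_def)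
  then show "qform a p v w = qform a p w v"
    unfolding qform_def by (subst sum.swap) (simp add: mult.commute mult.left_commute)
qed (use assms in \<open>auto simp: elliptic_at_def\<close>)

text \<open>The form is non-negative at \<open>x *\<^sub>R v - y *\<^sub>R w\<close>;
  expand.\<close>

lemma qform_young:
  assumes "elliptic_at a A p"
  shows "2 * (x * y) * qform a p v w \<le> x\<^sup>2 * qform a p v v + y\<^sup>2 * qform a p w w"
  using elliptic_atD(2)[OF assms, of "x *\<^sub>R v - y *\<^sub>R w"] elliptic_atD(1)[OF assms, of w v]
  by (simp add: qform_bilinear power2_eq_square algebra_simps)

lemma qform_young_abs:
  assumes "elliptic_at a A p" "c > 0"
  shows "2 * \<bar>qform a p v w\<bar> \<le> c * qform a p v v + qform a p w w / c"
proof -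
  \<comment> \<open>The two signs of the second weight together yield the absolute value.\<close>
  have "2 * (x * y) * qform a p v w \<le> c * qform a p v v + qform a p w w / c"
    if "x = sqrt c" "y = 1 / sqrt c \<or> y = - 1 / sqrt c" for x y
    using qform_young[OF assms(1), of x y v w] that assms(2) by (auto simp: power_divide)
  from this[of "sqrt c" "1 / sqrt c"] this[of "sqrt c" "- 1 / sqrt c"] show ?thesis
    using assms(2) by (auto simp: abs_if)
qed

text \<open>The parallelogram identity, with the other diagonal dropped because it is
  non-negative.\<close>

lemma qform_add_le:
  assumes "elliptic_at a A p"
  shows "qform a p (v + w) (v + w) \<le> 2 * qform a p v v + 2 * qform a p w w"
    and "qform a p (v - w) (v - w) \<le> 2 * qform a p v v + 2 * qform a p w w"
  using elliptic_atD(2)[OF assms, of "v - w"] elliptic_atD(2)[OF assms, of "v + w"]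
  by (simp_all add: qform_bilinear)

section \<open>Time derivatives and spatial gradients of composite functions\<close>

lemma has_derivative_dt_grad:
  assumes "(f has_derivative f') (at p)"
  shows "dt f p = f' (1, 0)" "grad f p = (\<chi> i. f' (0, axis i 1))"
  using frechet_derivative_at[OF assms] by (simp_all add: dt_def grad_def dx_def)

lemma dt_grad_zero:
  assumes "open U" "p \<in> U" "\<And>p. p \<in> U \<Longrightarrow> f p = 0"
  shows "dt f p = 0" "grad f p = 0"
proof -
  have "(f has_derivative (\<lambda>_. 0)) (at p)"
    by (rule has_derivative_transform_within_open[where f = "\<lambda>_. 0", OF _ assms(1,2)]) (simp_all add: assms(3))
  from has_derivative_dt_grad[OF this] show "dt f p = 0" "grad f p = 0"
    by (simp_all add: vec_eq_iff)
qed

lemma dt_grad_diff: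
  assumes "smooth_on U f" "smooth_on U g" "p \<in> U"
  shows "dt (\<lambda>p. f p - g p) p = dt f p - dt g p" "grad (\<lambda>p. f p - g p) p = grad f p - grad g p"
  using has_derivative_dt_grad[OF has_derivative_diff[OF assms(1,2)[THEN smooth_on_has_derivative, OF assms(3)]]]
  by (simp_all add: vec_eq_iff dt_def grad_def dx_def)

lemma dt_grad_mult:
  assumes "smooth_on U f" "smooth_on U g" "p \<in> U"
  shows "dt (\<lambda>p. f p * g p) p = dt f p * g p + f p * dt g p"
    "grad (\<lambda>p. f p * g p) p = g p *\<^sub>R grad f p + f p *\<^sub>R grad g p"
  using has_derivative_dt_grad[OF has_derivative_mult[OF assms(1,2)[THEN smooth_on_has_derivative, OF assms(3)]]]
  by (simp_all add: vec_eq_iff dt_def grad_def dx_def)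

lemma dt_grad_compose:
  assumes "smooth_on U f" "p \<in> U" "(h has_real_derivative h') (at (f p))"
  shows "dt (\<lambda>p. h (f p)) p = h' * dt f p" "grad (\<lambda>p. h (f p)) p = h' *\<^sub>R grad f p"
  using has_derivative_dt_grad[OF has_derivative_compose[OF smooth_on_has_derivative[OF assms(1,2)] assms(3)[unfolded has_field_derivative_def]]]
  by (simp_all add: vec_eq_iff dt_def grad_def dx_def)

lemma open_half_space: "open half_space"
  by (simp add: half_space_def open_Times)

section \<open>Measurability and integrability of the Dirichlet integrand\<close>

lemma AE_lebesgue_on_subset:
  assumes "AE p in lebesgue_on T. P p" "S \<subseteq> T" "S \<in> sets lebesgue" "T \<in> sets lebesgue"
  shows "AE p in lebesgue_on S. P p"
  using assms by (auto simp: AE_restrict_space_iff elim!: eventually_mono)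

lemma measurable_continuous_lebesgue_on:
  fixes f :: "'a::euclidean_space \<Rightarrow> real"
  assumes "open U" "continuous_on U f"
  shows "f \<in> borel_measurable (lebesgue_on U)"
  using assms by (intro continuous_imp_measurable_on_sets_lebesgue) (auto simp: borel_open)

lemma measurable_smooth:
  assumes "open U" "smooth_on U f"
  shows "f \<in> borel_measurable (lebesgue_on U)"
    "dt f \<in> borel_measurable (lebesgue_on U)"
    "dx i f \<in> borel_measurable (lebesgue_on U)"
  unfolding dt_def[abs_def] dx_def[abs_def]
  using assms by (auto intro!: measurable_continuous_lebesgue_on smooth_on_continuous smooth_on_continuous_frechet)

lemma finite_measure_lebesgue_on_bounded:
  fixes U :: "'a::euclidean_space set"
  assumes "open U" "bounded U"
  shows "finite_measure (lebesgue_on U)"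
proof -
  have "emeasure lebesgue U < \<infinity>"
    using emeasure_bounded_finite[OF assms(2)] assms(1) by (simp add: borel_open)
  then show ?thesis
    using assms(1) by (intro finite_measure_lebesgue_on) (auto simp: fmeasurable_def borel_open)
qed

locale elliptic_coeffs =
  fixes a :: "('n::finite) coeffs" and A :: "'n spacetime \<Rightarrow> real"
  assumes measurable_a: "\<And>i j. a i j \<in> borel_measurable (lebesgue_on half_space)"
    and elliptic: "AE p in lebesgue_on half_space. elliptic_at a A p"
    and A_bounded: "locally_bounded_on half_space A"
begin

lemma elliptic_on:
  assumes "open U" "U \<subseteq> half_space"
  shows "AE p in lebesgue_on U. p \<in> U \<and> elliptic_at a A p"
proof -
  have "AE p in lebesgue_on U. elliptic_at a A p"
    by (rule AE_lebesgue_on_subset[OF elliptic assms(2)])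
      (simp_all add: assms(1) borel_open open_half_space)
  moreover have "AE p in lebesgue_on U. p \<in> U"
    using AE_space[of "lebesgue_on U"] by simp
  ultimately show ?thesis by (rule AE_conjI[rotated])
qed

lemma measurable_dirichlet:
  assumes "open U" "U \<subseteq> half_space" "smooth_on U v" "smooth_on U w"
  shows "dirichlet a v w \<in> borel_measurable (lebesgue_on U)"
proof -
  have "a i j \<in> borel_measurable (lebesgue_on U)" for i j
    using measurable_restrict_mono[OF measurable_a assms(2)] .
  then show ?thesis
    unfolding dirichlet_def[abs_def]
    by (intro borel_measurable_sum borel_measurable_times measurable_smooth[OF assms(1,3)]
      measurable_smooth[OF assms(1,4)])
qed

text \<open>Young's inequality with weight 1 bounds the mixed integrand pointwise by the two pure
  ones.\<close>

lemma integrable_dirichlet: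
  assumes U: "open U" "U \<subseteq> half_space" and s: "smooth_on U v" "smooth_on U w"
    and i: "integrable (lebesgue_on U) (dirichlet a v v)" "integrable (lebesgue_on U) (dirichlet a w w)"
  shows "integrable (lebesgue_on U) (dirichlet a v w)"
proof (rule Bochner_Integration.integrable_bound)
  show "integrable (lebesgue_on U) (\<lambda>p. dirichlet a v v p + dirichlet a w w p)" using i by simp
  show "dirichlet a v w \<in> borel_measurable (lebesgue_on U)" by (rule measurable_dirichlet[OF U s])
  show "AE p in lebesgue_on U. norm (dirichlet a v w p) \<le> norm (dirichlet a v v p + dirichlet a w w p)"
    using elliptic_on[OF U]
  proof eventually_elim
    case (elim p)
    then show ?case
      using qform_young_abs[of a A p 1 "grad v p" "grad w p"] elliptic_atD(2)[of a A p]
      by (simp add: dirichlet_eq_qform)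
  qed
qed

lemma integrable_dirichlet_diff:
  assumes U: "open U" "U \<subseteq> half_space" and s: "smooth_on U v" "smooth_on U w"
    and i: "integrable (lebesgue_on U) (dirichlet a v v)" "integrable (lebesgue_on U) (dirichlet a w w)"
  defines "d \<equiv> \<lambda>p. v p - w p"
  shows "integrable (lebesgue_on U) (dirichlet a d d)"
proof (rule Bochner_Integration.integrable_bound)
  show "integrable (lebesgue_on U) (\<lambda>p. 2 * dirichlet a v v p + 2 * dirichlet a w w p)" using i by simp
  show "dirichlet a d d \<in> borel_measurable (lebesgue_on U)"
    unfolding d_def by (intro measurable_dirichlet U smooth_on_diff s)
  show "AE p in lebesgue_on U. norm (dirichlet a d d p) \<le> norm (2 * dirichlet a v v p + 2 * dirichlet a w w p)"
    using elliptic_on[OF U]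
  proof eventually_elim
    case (elim p)
    then show ?case
      using qform_add_le(2)[of a A p "grad v p" "grad w p"] elliptic_atD(2)[of a A p]
      by (simp add: dirichlet_eq_qform d_def dt_grad_diff[OF s])
  qed
qed

lemma LINT_dirichlet_nonneg:
  assumes "open U" "U \<subseteq> half_space"
  shows "0 \<le> (LINT p|lebesgue_on U. dirichlet a v v p)"
proof (rule integral_nonneg_AE)
  show "AE p in lebesgue_on U. 0 \<le> dirichlet a v v p"
    using elliptic_on[OF assms]
    by eventually_elim (simp add: dirichlet_eq_qform elliptic_atD(2)[of a A])
qed

text \<open>On \<open>K\<close> both \<open>A\<close> and the continuous gradient of
  \<open>z\<close> are bounded; off \<open>K\<close>, an open set, the gradient is zero.\<close>

lemma integrable_dirichlet_compact:
  assumes U: "open U" "U \<subseteq> half_space" "bounded U" and z: "smooth_on UNIV z"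
    and K: "compact K" "K \<subseteq> U" "\<And>p. p \<notin> K \<Longrightarrow> z p = 0"
  shows "integrable (lebesgue_on U) (dirichlet a z z)"
proof -
  have "bounded (A ` K)" using A_bounded K U unfolding locally_bounded_on_def by blast
  then obtain B where B: "B > 0" "\<And>p. p \<in> K \<Longrightarrow> \<bar>A p\<bar> \<le> B" unfolding bounded_pos by auto
  have "continuous_on K (grad z)"
    unfolding grad_def[abs_def] dx_def
    by (intro continuous_on_vec_lambda continuous_on_subset[OF smooth_on_continuous_frechet[OF z]]) auto
  then have "bounded (grad z ` K)" using K(1) by (intro compact_imp_bounded compact_continuous_image)
  then obtain C where C: "C > 0" "\<And>p. p \<in> K \<Longrightarrow> norm (grad z p) \<le> C" unfolding bounded_pos by auto
  show ?thesis
  proof (rule Bochner_Integration.integrable_bound)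
    show "integrable (lebesgue_on U) (\<lambda>p. B * C\<^sup>2)"
      by (rule finite_measure.integrable_const[OF finite_measure_lebesgue_on_bounded[OF U(1,3)]])
    show "dirichlet a z z \<in> borel_measurable (lebesgue_on U)"
      using z by (intro measurable_dirichlet U) (auto intro: smooth_on_subset)
    show "AE p in lebesgue_on U. norm (dirichlet a z z p) \<le> norm (B * C\<^sup>2)"
      using elliptic_on[OF U(1,2)]
    proof eventually_elim
      case (elim p)
      show ?case
      proof (cases "p \<in> K")
        case True
        have "qform a p (grad z p) (grad z p) \<le> A p * (norm (grad z p))\<^sup>2"
          using elim elliptic_atD(3) by blast
        also have "\<dots> \<le> B * C\<^sup>2"
          using B(2)[OF True] C(2)[OF True] B(1) by (intro mult_mono power_mono) auto
        finally show ?thesis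
          using elim elliptic_atD(2)[of a A p] by (simp add: dirichlet_eq_qform)
      next
        case False
        have "grad z p = 0"
          by (rule dt_grad_zero[of "- K"]) (use False K in \<open>auto simp: compact_imp_closed\<close>)
        then show ?thesis using B(1) by (simp add: dirichlet_eq_qform qform_zero)
      qed
    qed
  qed
qed

end

section \<open>Testing with functions of the approximating sequence\<close>

lemma powr_abs_add_le:
  fixes x y q :: real
  assumes "q \<ge> 0"
  shows "\<bar>x + y\<bar> powr q \<le> 2 powr q * (\<bar>x\<bar> powr q + \<bar>y\<bar> powr q)"
proof -
  have "\<bar>x + y\<bar> powr q \<le> (2 * max \<bar>x\<bar> \<bar>y\<bar>) powr q"
    using assms by (intro powr_mono2) auto
  also have "\<dots> = 2 powr q * (max \<bar>x\<bar> \<bar>y\<bar>) powr q" by (simp add: powr_mult)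
  also have "\<dots> \<le> 2 powr q * (\<bar>x\<bar> powr q + \<bar>y\<bar> powr q)"
    by (intro mult_left_mono) (auto simp: max_def)
  finally show ?thesis .
qed

lemma integrable_mult_bounded:
  fixes f g :: "'a \<Rightarrow> real"
  assumes "integrable M f" "g \<in> borel_measurable M" "AE x in M. \<bar>g x\<bar> \<le> B"
  shows "integrable M (\<lambda>x. f x * g x)"
proof (rule Bochner_Integration.integrable_bound)
  show "integrable M (\<lambda>x. B * f x)" using assms(1) by simp
  show "(\<lambda>x. f x * g x) \<in> borel_measurable M" using assms by measurable
  show "AE x in M. norm (f x * g x) \<le> norm (B * f x)"
    using assms(3)
  proof eventually_elim
    case (elim x)
    then have "\<bar>f x\<bar> * \<bar>g x\<bar> \<le> \<bar>f x\<bar> * \<bar>B\<bar>" by (intro mult_left_mono) auto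
    then show ?case by (simp add: abs_mult mult.commute)
  qed
qed

lemma L1_limit_LINT:
  assumes "L1_limit U f F"
  shows "(\<lambda>k. LINT p|lebesgue_on U. f k p) \<longlonglongrightarrow> (LINT p|lebesgue_on U. F p)"
proof (rule LIM_zero_cancel, rule Lim_null_comparison)
  have i: "integrable (lebesgue_on U) (f k)" "integrable (lebesgue_on U) F" for k
    using assms by (auto simp: L1_limit_def)
  show "(\<lambda>k. LINT p|lebesgue_on U. \<bar>f k p - F p\<bar>) \<longlonglongrightarrow> 0" using assms by (simp add: L1_limit_def)
  show "\<forall>\<^sub>F k in sequentially. norm ((LINT p|lebesgue_on U. f k p) - (LINT p|lebesgue_on U. F p))
      \<le> (LINT p|lebesgue_on U. \<bar>f k p - F p\<bar>)"
    using integral_norm_bound[of "lebesgue_on U" "\<lambda>p. f _ p - F p"] i by simp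
qed

text \<open>The modulus of the nonlinearity is \<open>\<bar>u\<bar> powr q\<close>, and
  \<open>u\<close> is the sum of \<open>s 0\<close> and \<open>u - s 0\<close>, whose
  \<open>q\<close>-th powers are integrable.\<close>

lemma W_represents_integrable:
  assumes rep: "W_represents a q U s u" and q: "q > 1"
  shows "integrable (lebesgue_on U) (\<lambda>p. \<bar>u p\<bar> powr (q - 1) * u p)"
proof (rule Bochner_Integration.integrable_bound)
  have [simp]: "qhat q = q" using q by (simp add: qhat_def)
  have iq: "integrable (lebesgue_on U) (\<lambda>p. \<bar>s 0 p\<bar> powr q)"
    and iqd: "integrable (lebesgue_on U) (\<lambda>p. \<bar>s 0 p - u p\<bar> powr q)"
    and um: "u \<in> borel_measurable (lebesgue_on U)"
    using rep by (auto simp: W_represents_def W_smooth_def)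
  show "integrable (lebesgue_on U) (\<lambda>p. 2 powr q * (\<bar>s 0 p\<bar> powr q + \<bar>s 0 p - u p\<bar> powr q))"
    using iq iqd by simp
  show "(\<lambda>p. \<bar>u p\<bar> powr (q - 1) * u p) \<in> borel_measurable (lebesgue_on U)" using um by measurable
  have "\<bar>u p\<bar> powr (q - 1) * \<bar>u p\<bar> = \<bar>u p\<bar> powr q" for p
    by (cases "u p = 0") (auto simp: powr_diff)
  moreover have "\<bar>u p\<bar> powr q \<le> 2 powr q * (\<bar>s 0 p\<bar> powr q + \<bar>s 0 p - u p\<bar> powr q)" for p
    using powr_abs_add_le[of q "s 0 p" "u p - s 0 p"] q by (simp add: abs_minus_commute)
  ultimately have "norm (\<bar>u p\<bar> powr (q - 1) * u p) \<le> norm (2 powr q * (\<bar>s 0 p\<bar> powr q + \<bar>s 0 p - u p\<bar> powr q))" for p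
    by (simp add: abs_mult)
  then show "AE p in lebesgue_on U. norm (\<bar>u p\<bar> powr (q - 1) * u p) \<le> norm (2 powr q * (\<bar>s 0 p\<bar> powr q + \<bar>s 0 p - u p\<bar> powr q))"
    by simp
qed

context elliptic_coeffs
begin

lemma W_represents_dirichlet_cauchy:
  assumes U: "open U" "U \<subseteq> half_space" and rep: "W_represents a q U s w" and "x > 0"
  shows "\<exists>N. \<forall>k\<ge>N. \<forall>l\<ge>N. (LINT p|lebesgue_on U. dirichlet a (\<lambda>p. s k p - s l p) (\<lambda>p. s k p - s l p) p) < x"
proof -
  \<comment> \<open>The norm contains the square root of the Dirichlet integral, hence the threshold
    \<open>sqrt x\<close>.\<close>
  have "\<exists>N. \<forall>k\<ge>N. \<forall>l\<ge>N. W_norm a q U (\<lambda>p. s k p - s l p) < sqrt x"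
    using rep \<open>x > 0\<close> unfolding W_represents_def by (metis real_sqrt_gt_zero)
  then obtain N where N: "\<And>k l. k \<ge> N \<Longrightarrow> l \<ge> N \<Longrightarrow> W_norm a q U (\<lambda>p. s k p - s l p) < sqrt x" by blast
  have "sqrt (LINT p|lebesgue_on U. dirichlet a w w p) \<le> W_norm a q U w" for w
    by (simp add: W_norm_def)
  then have "sqrt (LINT p|lebesgue_on U. dirichlet a (\<lambda>p. s k p - s l p) (\<lambda>p. s k p - s l p) p) < sqrt x"
    if "k \<ge> N" "l \<ge> N" for k l using N[OF that] by (rule order.strict_trans1)
  then show ?thesis by (intro exI[of _ N] allI impI) simp
qed

text \<open>Beyond a Cauchy index \<open>N\<close> every member differs from \<open>s N\<close> by a
  function of energy below 1; the parallelogram bound does the rest.\<close>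

lemma W_represents_dirichlet_bounded:
  assumes U: "open U" "U \<subseteq> half_space" and rep: "W_represents a q U s w"
  shows "\<exists>N E. \<forall>k\<ge>N. (LINT p|lebesgue_on U. dirichlet a (s k) (s k) p) \<le> E"
proof -
  obtain N where N: "\<And>k l. k \<ge> N \<Longrightarrow> l \<ge> N \<Longrightarrow>
      (LINT p|lebesgue_on U. dirichlet a (\<lambda>p. s k p - s l p) (\<lambda>p. s k p - s l p) p) < 1"
    using W_represents_dirichlet_cauchy[OF assms, of 1] by auto
  have sm: "smooth_on U (s k)" and i: "integrable (lebesgue_on U) (dirichlet a (s k) (s k))" for k
    using rep by (auto simp: W_represents_def W_smooth_def)
  have "(LINT p|lebesgue_on U. dirichlet a (s k) (s k) p) \<le>
      2 * (LINT p|lebesgue_on U. dirichlet a (s N) (s N) p) + 2" if "k \<ge> N" for k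
  proof -
    let ?d = "\<lambda>p. s N p - s k p"
    have id: "integrable (lebesgue_on U) (dirichlet a ?d ?d)"
      by (intro integrable_dirichlet_diff U sm i)
    have "(LINT p|lebesgue_on U. dirichlet a (s k) (s k) p) \<le>
      (LINT p|lebesgue_on U. 2 * dirichlet a (s N) (s N) p + 2 * dirichlet a ?d ?d p)"
    proof (rule integral_mono_AE)
      show "AE p in lebesgue_on U. dirichlet a (s k) (s k) p \<le> 2 * dirichlet a (s N) (s N) p + 2 * dirichlet a ?d ?d p"
        using elliptic_on[OF U]
      proof eventually_elim
        case (elim p)
        then show ?case
          using qform_add_le(2)[of a A p "grad (s N) p" "grad ?d p"]
          by (simp add: dirichlet_eq_qform dt_grad_diff[OF sm sm])
      qed
    qed (use i id in auto)
    also have "\<dots> \<le> 2 * (LINT p|lebesgue_on U. dirichlet a (s N) (s N) p) + 2 * 1"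
      using N[of N k] that i id by simp
    finally show ?thesis by simp
  qed
  then show ?thesis by blast
qed

text \<open>Each \<open>\<phi> k\<close> is an admissible test function, but its weak inequality
  contains the limits \<open>ut\<close> and \<open>G\<close>. They are replaced by expressions in
  \<open>s k\<close> alone, at a cost of \<open>\<eta> / 2\<close> each. As the test function varies
  with \<open>k\<close>, convergence for one fixed test function does not suffice; the argument
  combines a bound on the energy of \<open>\<phi> k\<close> uniform in \<open>k\<close> with the
  Cauchy property of \<open>s\<close> in energy.\<close>

lemma weak_test_limit:
  fixes z :: "'n spacetime \<Rightarrow> real"
  assumes U: "open U" "U \<subseteq> half_space" "bounded U"
    and q: "q > 1" and rep: "W_represents a q U s u" and ut: "L1_limit U (\<lambda>k. dt (s k)) ut"
    and weak: "\<And>\<phi>. test_function \<phi> \<Longrightarrow> (\<And>p. p \<notin> K \<Longrightarrow> \<phi> p = 0) \<Longrightarrow>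
      \<exists>G. L1_limit U (\<lambda>k. dirichlet a \<phi> (s k)) G \<and>
        0 \<le> (LINT p|lebesgue_on U. ut p * \<phi> p + G p - \<bar>u p\<bar> powr (q - 1) * u p * \<phi> p)"
    and z: "smooth_on UNIV z" "\<And>p. 0 \<le> z p" "\<And>p. z p \<le> 1"
    and K: "compact K" "K \<subseteq> U" "\<And>p. p \<notin> K \<Longrightarrow> z p = 0"
    and de: "d > 0" "e > 0" and "\<eta> > 0"
  defines "\<phi> \<equiv> \<lambda>k p. psi d e (s k p) * z p"
  shows "\<exists>N. \<forall>k\<ge>N.
    integrable (lebesgue_on U) (dirichlet a (\<phi> k) (s k)) \<and>
    integrable (lebesgue_on U) (\<lambda>p. dt (s k) p * \<phi> k p) \<and>
    integrable (lebesgue_on U) (\<lambda>p. \<bar>u p\<bar> powr (q - 1) * u p * \<phi> k p) \<and>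
    (LINT p|lebesgue_on U. \<bar>u p\<bar> powr (q - 1) * u p * \<phi> k p) \<le>
      (LINT p|lebesgue_on U. dt (s k) p * \<phi> k p) + (LINT p|lebesgue_on U. dirichlet a (\<phi> k) (s k) p) + \<eta>"
proof -
  have [simp]: "qhat q = q" using q by (simp add: qhat_def)
  have sm: "smooth_on U (s k)" and i: "integrable (lebesgue_on U) (dirichlet a (s k) (s k))"
    and it: "integrable (lebesgue_on U) (\<lambda>p. \<bar>dt (s k) p\<bar>)"
    and iq: "integrable (lebesgue_on U) (\<lambda>p. \<bar>s k p\<bar> powr q)" for k
    using rep by (auto simp: W_represents_def W_smooth_def)
  have um: "u \<in> borel_measurable (lebesgue_on U)" and iqd: "integrable (lebesgue_on U) (\<lambda>p. \<bar>s k p - u p\<bar> powr q)" for k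
    using rep by (auto simp: W_represents_def)
  have idt: "integrable (lebesgue_on U) (dt (s k))" for k
    using it integrable_abs_cancel[OF it measurable_smooth(2)[OF U(1) sm]] by blast
  have iut: "integrable (lebesgue_on U) ut" using ut by (simp add: L1_limit_def)
  have zU: "smooth_on U z" using z(1) by (rule smooth_on_subset) simp
  have spsi: "smooth_on U (\<lambda>p. psi d e (s k p))" for k by (rule smooth_on_psi[OF U(1) sm])
  have s\<phi>: "smooth_on U (\<phi> k)" for k unfolding \<phi>_def by (rule smooth_on_mult[OF U(1) spsi zU])
  have \<phi>0: "0 \<le> \<phi> k p" and \<phi>2: "\<phi> k p \<le> 2" for k p
  proof -
    show "0 \<le> \<phi> k p" using psi_bounds(1)[of d e "s k p"] z by (simp add: \<phi>_def)
    have "psi d e (s k p) * z p \<le> 2 * 1"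
      using psi_bounds[of d e "s k p"] z by (intro mult_mono) auto
    then show "\<phi> k p \<le> 2" by (simp add: \<phi>_def)
  qed
  have \<phi>K: "\<phi> k p = 0" if "p \<notin> K" for k p using K(3)[OF that] by (simp add: \<phi>_def)
  have test: "test_function (\<phi> k)" for k
    unfolding test_function_def
  proof (intro conjI exI[of _ K])
    \<comment> \<open>\<open>s k\<close> is smooth on \<open>U\<close> only. Off \<open>K\<close>
      the product is zero, and the two open sets cover the half-space.\<close>
    have "open (half_space - K)" using open_half_space K(1) by (intro open_Diff compact_imp_closed)
    moreover from this have "smooth_on (half_space - K) (\<phi> k)"
      by (rule smooth_on_cong[where f = "\<lambda>_. 0"]) (auto simp: \<phi>K intro: smooth_on_const calculation)
    moreover have "half_space = U \<union> (half_space - K)" using U K by auto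
    ultimately show "smooth_on half_space (\<phi> k)" using smooth_on_Un[OF U(1) _ s\<phi>] by metis
  qed (use \<phi>0 \<phi>K K U in auto)
  have gr: "grad (\<phi> k) p = (psi' d e (s k p) * z p) *\<^sub>R grad (s k) p + psi d e (s k p) *\<^sub>R grad z p"
    if "p \<in> U" for k p
    unfolding \<phi>_def using dt_grad_mult(2)[OF spsi zU that] dt_grad_compose(2)[OF sm that DERIV_psi[OF de(2)]]
    by (simp add: mult.commute)
  have iz: "integrable (lebesgue_on U) (dirichlet a z z)"
    by (rule integrable_dirichlet_compact[OF U z(1) K])
  \<comment> \<open>Bound for the energy density of \<open>\<phi> k\<close>: its gradient has the
    parts \<open>psi' * z * grad s\<close> and \<open>psi * grad z\<close>, with
    \<open>\<bar>psi' * z\<bar> \<le> d / e\<close> and \<open>psi \<le> 2\<close>; the 8 is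
    \<open>2 * 2\<^sup>2\<close>.\<close>
  let ?B = "\<lambda>k p. 2 * (d / e)\<^sup>2 * dirichlet a (s k) (s k) p + 8 * dirichlet a z z p"
  have D\<phi>: "AE p in lebesgue_on U. dirichlet a (\<phi> k) (\<phi> k) p \<le> ?B k p" for k
    using elliptic_on[OF U(1,2)]
  proof eventually_elim
    case (elim p)
    then have e: "elliptic_at a A p" and p: "p \<in> U" by auto
    note pos = elliptic_atD(2)[OF e]
    have "\<bar>psi' d e (s k p) * z p\<bar> \<le> (d / e) * 1"
      unfolding abs_mult using psi'_abs_le[OF de, of "s k p"] z(2,3)[of p] de
      by (intro mult_mono) auto
    then have 1: "(psi' d e (s k p) * z p)\<^sup>2 \<le> (d / e)\<^sup>2"
      using power_mono[of "\<bar>psi' d e (s k p) * z p\<bar>" "d / e" 2] by simp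
    have 2: "(psi d e (s k p))\<^sup>2 \<le> 2\<^sup>2"
      using psi_bounds[of d e "s k p"] by (intro power_mono) auto
    have "dirichlet a (\<phi> k) (\<phi> k) p \<le> 2 * ((psi' d e (s k p) * z p)\<^sup>2 * dirichlet a (s k) (s k) p)
        + 2 * ((psi d e (s k p))\<^sup>2 * dirichlet a z z p)"
      using qform_add_le(1)[OF e, of "(psi' d e (s k p) * z p) *\<^sub>R grad (s k) p" "psi d e (s k p) *\<^sub>R grad z p"]
      by (simp add: dirichlet_eq_qform gr[OF p] qform_scaleR_left qform_scaleR_right power2_eq_square mult_ac)
    also have "\<dots> \<le> 2 * ((d / e)\<^sup>2 * dirichlet a (s k) (s k) p) + 2 * (2\<^sup>2 * dirichlet a z z p)"
      using 1 2 pos by (intro add_mono mult_left_mono mult_right_mono) (auto simp: dirichlet_eq_qform)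
    finally show ?case by simp
  qed
  have i\<phi>: "integrable (lebesgue_on U) (dirichlet a (\<phi> k) (\<phi> k))" for k
  proof (rule Bochner_Integration.integrable_bound)
    show "integrable (lebesgue_on U) (?B k)" using i iz by simp
    show "dirichlet a (\<phi> k) (\<phi> k) \<in> borel_measurable (lebesgue_on U)"
      by (rule measurable_dirichlet[OF U(1,2) s\<phi> s\<phi>])
    show "AE p in lebesgue_on U. norm (dirichlet a (\<phi> k) (\<phi> k) p) \<le> norm (?B k p)"
      using D\<phi>[of k] elliptic_on[OF U(1,2)]
      by eventually_elim (simp add: dirichlet_eq_qform elliptic_atD(2)[of a A])
  qed
  have i\<phi>s: "integrable (lebesgue_on U) (dirichlet a (\<phi> k) (s k))" for k
    by (rule integrable_dirichlet[OF U(1,2) s\<phi> sm i\<phi> i])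
  obtain N0 E where N0: "\<And>k. k \<ge> N0 \<Longrightarrow> (LINT p|lebesgue_on U. dirichlet a (s k) (s k) p) \<le> E"
    using W_represents_dirichlet_bounded[OF U(1,2) rep] by auto
  define F where "F = 2 * (d / e)\<^sup>2 * E + 8 * (LINT p|lebesgue_on U. dirichlet a z z p)"
  have F: "(LINT p|lebesgue_on U. dirichlet a (\<phi> k) (\<phi> k) p) \<le> F" if "k \<ge> N0" for k
  proof -
    have "(LINT p|lebesgue_on U. dirichlet a (\<phi> k) (\<phi> k) p) \<le> (LINT p|lebesgue_on U. ?B k p)"
      by (rule integral_mono_AE) (use i\<phi> i iz D\<phi> in auto)
    also have "\<dots> = 2 * (d / e)\<^sup>2 * (LINT p|lebesgue_on U. dirichlet a (s k) (s k) p) + 8 * (LINT p|lebesgue_on U. dirichlet a z z p)"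
      using i iz by simp
    also have "\<dots> \<le> F" unfolding F_def using N0[OF that] by (intro add_mono mult_left_mono) auto
    finally show ?thesis .
  qed
  have "0 \<le> F" using F[of N0] LINT_dirichlet_nonneg[OF U(1,2), of "\<phi> N0"] by simp
  \<comment> \<open>The weight in Young's inequality: \<open>c / 2 * F\<close> is at most
    \<open>\<eta> / 4\<close>, and the energy threshold \<open>c * \<eta> / 2\<close> for
    \<open>s k - s l\<close>, divided by \<open>2 * c\<close>, gives another
    \<open>\<eta> / 4\<close>.\<close>
  define c where "c = \<eta> / (2 * (F + 1))"
  have c: "c > 0" "c * F \<le> \<eta> / 2"
    using \<open>0 \<le> F\<close> \<open>\<eta> > 0\<close> by (auto simp: c_def field_simps)
  obtain N1 where N1: "\<And>k l. k \<ge> N1 \<Longrightarrow> l \<ge> N1 \<Longrightarrow>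
      (LINT p|lebesgue_on U. dirichlet a (\<lambda>p. s k p - s l p) (\<lambda>p. s k p - s l p) p) < c * \<eta> / 2"
    using W_represents_dirichlet_cauchy[OF U(1,2) rep, of "c * \<eta> / 2"] c \<open>\<eta> > 0\<close> by auto
  \<comment> \<open>Since \<open>\<phi> k \<le> 2\<close>, a distance of \<open>\<eta> / 4\<close>
    costs at most \<open>\<eta> / 2\<close>.\<close>
  have "(\<lambda>k. LINT p|lebesgue_on U. \<bar>dt (s k) p - ut p\<bar>) \<longlonglongrightarrow> 0" using ut by (simp add: L1_limit_def)
  from order_tendstoD(2)[OF this, of "\<eta> / 4"] obtain N2 where
    N2: "\<And>k. k \<ge> N2 \<Longrightarrow> (LINT p|lebesgue_on U. \<bar>dt (s k) p - ut p\<bar>) < \<eta> / 4"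
    using \<open>\<eta> > 0\<close> by (auto simp: eventually_sequentially)
  have \<phi>m: "\<phi> k \<in> borel_measurable (lebesgue_on U)" for k by (rule measurable_smooth(1)[OF U(1) s\<phi>])
  have \<phi>b: "AE p in lebesgue_on U. \<bar>\<phi> k p\<bar> \<le> 2" for k using \<phi>0 \<phi>2 by simp
  have iuq: "integrable (lebesgue_on U) (\<lambda>p. \<bar>u p\<bar> powr (q - 1) * u p)"
    by (rule W_represents_integrable[OF rep q])
  show ?thesis
  proof (intro exI[of _ "Max {N0, N1, N2}"] allI impI conjI)
    fix k assume "k \<ge> Max {N0, N1, N2}"
    then have k: "k \<ge> N0" "k \<ge> N1" "k \<ge> N2" by auto
    show "integrable (lebesgue_on U) (dirichlet a (\<phi> k) (s k))" by (rule i\<phi>s)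
    show ids: "integrable (lebesgue_on U) (\<lambda>p. dt (s k) p * \<phi> k p)"
      by (rule integrable_mult_bounded[OF idt \<phi>m \<phi>b])
    have iuts: "integrable (lebesgue_on U) (\<lambda>p. ut p * \<phi> k p)"
      by (rule integrable_mult_bounded[OF iut \<phi>m \<phi>b])
    show ius: "integrable (lebesgue_on U) (\<lambda>p. \<bar>u p\<bar> powr (q - 1) * u p * \<phi> k p)"
      by (rule integrable_mult_bounded[OF iuq \<phi>m \<phi>b])
    obtain G where G: "L1_limit U (\<lambda>l. dirichlet a (\<phi> k) (s l)) G"
      "0 \<le> (LINT p|lebesgue_on U. ut p * \<phi> k p + G p - \<bar>u p\<bar> powr (q - 1) * u p * \<phi> k p)"
      using weak[OF test \<phi>K] by blast
    have iG: "integrable (lebesgue_on U) G" using G(1) by (simp add: L1_limit_def)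
    have "(LINT p|lebesgue_on U. \<bar>u p\<bar> powr (q - 1) * u p * \<phi> k p) \<le> (LINT p|lebesgue_on U. ut p * \<phi> k p) + (LINT p|lebesgue_on U. G p)"
      using G(2) iuts iG ius by simp
    moreover have "(LINT p|lebesgue_on U. ut p * \<phi> k p) \<le> (LINT p|lebesgue_on U. dt (s k) p * \<phi> k p) + \<eta> / 2"
    proof -
      have "(LINT p|lebesgue_on U. ut p * \<phi> k p) - (LINT p|lebesgue_on U. dt (s k) p * \<phi> k p)
          = (LINT p|lebesgue_on U. ut p * \<phi> k p - dt (s k) p * \<phi> k p)" using iuts ids by simp
      also have "\<dots> \<le> (LINT p|lebesgue_on U. 2 * \<bar>dt (s k) p - ut p\<bar>)"
      proof (rule integral_mono)
        fix p
        have "(ut p - dt (s k) p) * \<phi> k p \<le> \<bar>dt (s k) p - ut p\<bar> * 2"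
          using \<phi>0[of k p] \<phi>2[of k p] by (intro mult_mono) auto
        then show "ut p * \<phi> k p - dt (s k) p * \<phi> k p \<le> 2 * \<bar>dt (s k) p - ut p\<bar>" by (simp add: algebra_simps)
      qed (use iuts ids idt iut in auto)
      finally show ?thesis using N2[OF k(3)] by simp
    qed
    \<comment> \<open>Here \<open>k\<close>, and with it the test function, stays fixed, while
      \<open>l\<close> runs along the sequence that defines \<open>G\<close>.\<close>
    moreover have "(LINT p|lebesgue_on U. G p) \<le> (LINT p|lebesgue_on U. dirichlet a (\<phi> k) (s k) p) + \<eta> / 2"
    proof (rule LIMSEQ_le_const2[OF L1_limit_LINT[OF G(1)]], intro exI[of _ N1] allI impI)
      fix l assume l: "l \<ge> N1"
      let ?d = "\<lambda>p. s k p - s l p"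
      have id: "integrable (lebesgue_on U) (dirichlet a ?d ?d)"
        by (intro integrable_dirichlet_diff U sm i)
      have il: "integrable (lebesgue_on U) (dirichlet a (\<phi> k) (s l))"
        using G(1) by (simp add: L1_limit_def)
      have "(LINT p|lebesgue_on U. dirichlet a (\<phi> k) (s l) p) - (LINT p|lebesgue_on U. dirichlet a (\<phi> k) (s k) p)
        = (LINT p|lebesgue_on U. dirichlet a (\<phi> k) (s l) p - dirichlet a (\<phi> k) (s k) p)" using il i\<phi>s by simp
      also have "\<dots> \<le> (LINT p|lebesgue_on U. (c / 2) * dirichlet a (\<phi> k) (\<phi> k) p + (1 / (2 * c)) * dirichlet a ?d ?d p)"
      proof (rule integral_mono_AE)
        show "AE p in lebesgue_on U. dirichlet a (\<phi> k) (s l) p - dirichlet a (\<phi> k) (s k) p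
            \<le> (c / 2) * dirichlet a (\<phi> k) (\<phi> k) p + (1 / (2 * c)) * dirichlet a ?d ?d p"
          using elliptic_on[OF U(1,2)]
        proof eventually_elim
          case (elim p)
          have "dirichlet a (\<phi> k) (s l) p - dirichlet a (\<phi> k) (s k) p = - qform a p (grad (\<phi> k) p) (grad ?d p)"
            using elim by (simp add: dirichlet_eq_qform dt_grad_diff[OF sm sm] qform_diff_right)
          also have "\<dots> \<le> \<bar>qform a p (grad (\<phi> k) p) (grad ?d p)\<bar>" by simp
          also have "\<dots> \<le> (c * dirichlet a (\<phi> k) (\<phi> k) p + dirichlet a ?d ?d p / c) / 2"
            using qform_young_abs[of a A p c "grad (\<phi> k) p" "grad ?d p"] elim c
            by (simp add: dirichlet_eq_qform)
          finally show ?case by (simp add: add_divide_distrib mult.commute)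
        qed
      qed (use il i\<phi>s i\<phi> id in auto)
      also have "\<dots> = (c / 2) * (LINT p|lebesgue_on U. dirichlet a (\<phi> k) (\<phi> k) p) + (1 / (2 * c)) * (LINT p|lebesgue_on U. dirichlet a ?d ?d p)"
        using i\<phi> id by simp
      also have "\<dots> \<le> (c / 2) * F + (1 / (2 * c)) * (c * \<eta> / 2)"
        using F[OF k(1)] N1[OF k(2) l] c by (intro add_mono mult_left_mono) auto
      also have "\<dots> \<le> \<eta> / 2" using c by (simp add: field_simps)
      finally show "(LINT p|lebesgue_on U. dirichlet a (\<phi> k) (s l) p) \<le> (LINT p|lebesgue_on U. dirichlet a (\<phi> k) (s k) p) + \<eta> / 2" by simp
    qed
    ultimately show "(LINT p|lebesgue_on U. \<bar>u p\<bar> powr (q - 1) * u p * \<phi> k p) \<le>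
      (LINT p|lebesgue_on U. dt (s k) p * \<phi> k p) + (LINT p|lebesgue_on U. dirichlet a (\<phi> k) (s k) p) + \<eta>" by simp
  qed
qed

end

section \<open>Integration by parts in time\<close>

text \<open>Fubini, with the fundamental theorem of calculus on each line parallel to the time
  axis.\<close>

lemma integral_time_derivative_zero:
  fixes g h :: "real \<times> 'a::euclidean_space \<Rightarrow> real"
  assumes D: "\<And>t x. ((\<lambda>t. g (t, x)) has_real_derivative h (t, x)) (at t)"
    and h: "continuous_on UNIV h"
    and K: "compact K" "\<And>p. p \<notin> K \<Longrightarrow> g p = 0" "\<And>p. p \<notin> K \<Longrightarrow> h p = 0"
  shows "integrable lborel h" "(LINT p|lborel. h p) = 0"
proof -
  have "integrable lborel (\<lambda>p. indicator K p *\<^sub>R h p)"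
    by (rule borel_integrable_compact[OF K(1)]) (rule continuous_on_subset[OF h], simp)
  moreover have "indicator K p *\<^sub>R h p = h p" for p using K(3)[of p] by (cases "p \<in> K") simp_all
  then have "(\<lambda>p. indicator K p *\<^sub>R h p) = h" by (rule ext)
  ultimately show ih: "integrable lborel h" by simp
  have "bounded (fst ` K)" using K(1) by (intro compact_imp_bounded compact_continuous_image continuous_intros)
  then obtain M where M: "M > 0" "\<And>p. p \<in> K \<Longrightarrow> \<bar>fst p\<bar> \<le> M" unfolding bounded_pos by auto
  have inner: "(LINT t|lborel. h (t, x)) = 0" for x
  proof -
    have out: "(t, x) \<notin> K" if "t \<notin> {- M..M}" for t using M(2)[of "(t, x)"] that by auto
    \<comment> \<open>The interval reaches 1 beyond the time extent of \<open>K\<close>, so that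
      \<open>g\<close> vanishes at both ends.\<close>
    have "(LINT t|lborel. h (t, x) * indicator {- (M + 1)..M + 1} t) = g (M + 1, x) - g (- (M + 1), x)"
    proof (rule integral_FTC_Icc_real)
      show "isCont (\<lambda>t. h (t, x)) t" for t
        by (rule continuous_on_interior[where S = UNIV])
          (auto intro!: continuous_on_compose2[OF h] continuous_intros)
    qed (use M D in auto)
    also have "\<dots> = 0" using out[of "M + 1"] out[of "- (M + 1)"] K(2) by auto
    also have "(\<lambda>t. h (t, x) * indicator {- (M + 1)..M + 1} t) = (\<lambda>t. h (t, x))"
    proof
      fix t
      show "h (t, x) * indicator {- (M + 1)..M + 1} t = h (t, x)"
        using K(3)[OF out, of t] by (cases "t \<in> {- M..M}") auto
    qed
    finally show ?thesis .
  qed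
  have "(LINT p|lborel. h p) = (LINT x|lborel. (LINT t|lborel. h (t, x)))"
    using lborel_pair.integral_snd[of "\<lambda>t x. h (t, x)"] ih by (simp add: lborel_prod)
  then show "(LINT p|lborel. h p) = 0" by (simp add: inner)
qed

text \<open>The integrand is the time derivative of \<open>F (s p) * z p\<close>, continued by zero
  outside \<open>U\<close>. With \<open>f = psi d e\<close> it moves the time derivative from
  \<open>s\<close> to the cutoff.\<close>

lemma weak_time_derivative:
  fixes s z :: "('n::finite) spacetime \<Rightarrow> real"
  assumes U: "open U" and s: "smooth_on U s" and z: "smooth_on UNIV z"
    and K: "compact K" "K \<subseteq> U" "\<And>p. p \<notin> K \<Longrightarrow> z p = 0"
    and f: "\<And>x. (F has_real_derivative f x) (at x)" "continuous_on UNIV f"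
  shows "integrable (lebesgue_on U) (\<lambda>p. f (s p) * dt s p * z p + F (s p) * dt z p)"
    and "(LINT p|lebesgue_on U. f (s p) * dt s p * z p + F (s p) * dt z p) = 0"
proof -
  define h where "h = (\<lambda>p. f (s p) * dt s p * z p + F (s p) * dt z p)"
  have zK: "dt z p = 0" if "p \<notin> K" for p
    by (rule dt_grad_zero(1)[of "- K"]) (use that K in \<open>auto simp: compact_imp_closed\<close>)
  have hK: "h p = 0" if "p \<notin> K" for p using that K(3) zK by (simp add: h_def)
  have F: "continuous_on UNIV F"
    using f(1) by (intro continuous_at_imp_continuous_on) (auto intro: DERIV_isCont)
  have zU: "smooth_on U z" using z by (rule smooth_on_subset) simp
  have o: "open (- K)" using K(1) by (simp add: compact_imp_closed open_Compl)
  have "continuous_on U h"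
    unfolding h_def dt_def
    by (intro continuous_intros smooth_on_continuous_frechet s zU smooth_on_continuous
        continuous_on_compose2[OF F] continuous_on_compose2[OF f(2)]) auto
  moreover have "continuous_on (- K) h"
    using continuous_on_cong[of "- K" "- K" h "\<lambda>_. 0"] hK by simp
  ultimately have "continuous_on (U \<union> - K) h" by (intro continuous_on_open_Un U o)
  moreover have "U \<union> - K = UNIV" using K by auto
  ultimately have ch: "continuous_on UNIV h" by simp
  have D: "((\<lambda>t. F (s (t, x)) * z (t, x)) has_real_derivative h (t, x)) (at t)" for t x
  proof (cases "(t, x) \<in> U")
    case True
    have l: "((\<lambda>t. (t, x)) has_derivative (\<lambda>h. (h, 0))) (at t)"
      by (auto intro!: derivative_eq_intros)
    have ds: "((\<lambda>t. w (t, x)) has_real_derivative dt w (t, x)) (at t)" if "smooth_on U w" for w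
    proof -
      let ?D = "frechet_derivative w (at (t, x))"
      have w: "(w has_derivative ?D) (at (t, x))" by (rule smooth_on_has_derivative[OF that True])
      have "((\<lambda>t. w (t, x)) has_derivative (\<lambda>h. ?D (h, 0))) (at t)"
        by (rule has_derivative_compose[OF l w])
      moreover have "?D (h, 0) = dt w (t, x) * h" for h
        using linear_scale[OF has_derivative_linear[OF w], of h "(1, 0)"] by (simp add: dt_def mult.commute)
      ultimately show ?thesis by (simp add: has_field_derivative_def)
    qed
    show ?thesis
      using DERIV_mult[OF DERIV_chain2[OF f(1) ds[OF s]] ds[OF zU]]
      by (simp add: h_def algebra_simps)
  next
    case False
    then have p: "(t, x) \<in> - K" using K by auto
    then have "open ((\<lambda>t. (t, x)) -` (- K))" "t \<in> (\<lambda>t. (t, x)) -` (- K)"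
      using o by (auto intro!: open_vimage continuous_intros)
    then show ?thesis
      by (rule has_field_derivative_transform_within_open[where f = "\<lambda>_. 0", rotated])
        (use hK p K(3) in auto)
  qed
  from integral_time_derivative_zero[OF D ch K(1)] K(3) hK
  have "integrable lborel h" "(LINT p|lborel. h p) = 0" by auto
  moreover have "h \<in> borel_measurable lborel" using ch by (simp add: borel_measurable_continuous_onI)
  ultimately have i: "integrable lebesgue h" "(LINT p|lebesgue. h p) = 0"
    by (simp_all add: integrable_completion integral_completion)
  have eq: "indicator U p *\<^sub>R h p = h p" for p using hK[of p] K by (auto simp: indicator_def)
  have Us: "U \<inter> space lebesgue \<in> sets lebesgue" using U by (simp add: borel_open)
  have "integrable (lebesgue_on U) h"
    unfolding integrable_restrict_space[OF Us] set_integrable_def eq by (rule i(1))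
  moreover have "(LINT p|lebesgue_on U. h p) = 0"
    unfolding integral_restrict_space[OF Us] set_lebesgue_integral_def eq by (rule i(2))
  ultimately show "integrable (lebesgue_on U) (\<lambda>p. f (s p) * dt s p * z p + F (s p) * dt z p)"
    "(LINT p|lebesgue_on U. f (s p) * dt s p * z p + F (s p) * dt z p) = 0" by (simp_all add: h_def)
qed

section \<open>Cutoff functions\<close>

text \<open>If \<open>\<bar>x\<bar> > b\<close>, then \<open>\<bar>x\<bar> powr (1 - q)\<close> is
  at most \<open>b powr (1 - q)\<close>. On a set of finite measure this controls an error in
  \<open>L\<^sup>1\<close> by one in \<open>L\<^sup>q\<close> and a small constant.\<close>

lemma abs_le_small_plus_powr:
  fixes x q :: real
  assumes "q > 1" "b > 0"
  shows "\<bar>x\<bar> \<le> b + b powr (1 - q) * \<bar>x\<bar> powr q"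
proof (cases "\<bar>x\<bar> \<le> b")
  case False
  then have "\<bar>x\<bar> powr (1 - q) \<le> b powr (1 - q)"
    using assms by (intro powr_mono2') auto
  then have "\<bar>x\<bar> powr (1 - q) * \<bar>x\<bar> powr q \<le> b powr (1 - q) * \<bar>x\<bar> powr q"
    by (intro mult_right_mono) auto
  moreover have "\<bar>x\<bar> powr (1 - q) * \<bar>x\<bar> powr q = \<bar>x\<bar>"
    using False assms by (simp flip: powr_add)
  ultimately show ?thesis using assms by simp
qed (use assms in \<open>simp add: add_increasing2\<close>)

text \<open>For \<open>y > 1\<close> the hypothesis on \<open>n\<close> gives
  \<open>x ^ n \<le> (x ^ (n + 2)) powr (r / q)\<close>, so the left side is at most
  \<open>2 powr r * Z powr (r / q)\<close> with \<open>Z = y powr q * x ^ (n + 2)\<close>, and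
  \<open>Z powr (r / q) \<le> 1 + Z\<close> because \<open>r \<le> q\<close>. It trades the power
  left by the weight \<open>psi\<close> for the power \<open>q\<close>, and recovers the two powers
  of the cutoff lost by differentiating.\<close>

lemma weight_young:
  fixes x y q r :: real
  assumes y: "y \<ge> 0" and x: "0 \<le> x" "x \<le> 1" and r: "0 < r" "r \<le> q"
    and n: "n \<ge> 1" "real (n + 2) * r \<le> real n * q"
  shows "(1 + y) powr r * x ^ n \<le> 2 powr r * (1 + y powr q * x ^ (n + 2))"
proof (cases "x = 0")
  case True
  then show ?thesis using n by (simp add: power_0_left)
next
  case False
  then have x0: "x > 0" using x by simp
  have nn: "0 \<le> y powr q * x ^ (n + 2)" using x by simp
  show ?thesis
  proof (cases "y \<le> 1")
    case True
    have "(1 + y) powr r * x ^ n \<le> 2 powr r * 1"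
      using True y x r by (intro mult_mono powr_mono2 power_le_one) auto
    also have "\<dots> \<le> 2 powr r * (1 + y powr q * x ^ (n + 2))"
      using nn by (intro mult_left_mono) auto
    finally show ?thesis .
  next
    case False
    define Z where "Z = y powr q * x ^ (n + 2)"
    have Zr: "Z powr (r / q) \<le> 1 + Z"
    proof (cases "Z \<le> 1")
      case True
      then show ?thesis using powr_le1[of "r / q" Z] nn r by (simp add: Z_def)
    next
      case False
      then have "Z powr (r / q) \<le> Z powr 1" using r by (intro powr_mono) auto
      then show ?thesis using False by simp
    qed
    have "x powr real n \<le> x powr (real (n + 2) * (r / q))"
      using n r x x0 by (intro powr_mono') (auto simp: field_simps)
    then have xn: "x ^ n \<le> x powr (real (n + 2) * (r / q))" using x0 by (simp add: powr_realpow)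
    have Z: "Z = y powr q * x powr real (n + 2)"
      using x0 by (simp only: Z_def powr_realpow)
    have "(1 + y) powr r * x ^ n \<le> (2 * y) powr r * x powr (real (n + 2) * (r / q))"
      using False r x xn by (intro mult_mono powr_mono2) auto
    also have "\<dots> = 2 powr r * Z powr (r / q)"
      using r unfolding Z by (simp add: powr_mult powr_powr)
    also have "\<dots> \<le> 2 powr r * (1 + Z)" using Zr by (intro mult_left_mono) auto
    finally show ?thesis by (simp add: Z_def)
  qed
qed

text \<open>Time is cut between \<open>R powr \<alpha>\<close> and twice that value, space between
  radii \<open>R / 2\<close> and \<open>R\<close>. The norm is squared for smoothness at the origin;
  the argument of the second \<open>step\<close> runs from 0 to 1 between these radii.\<close>

definition cut_xi :: "real \<Rightarrow> real \<Rightarrow> ('n::finite) spacetime \<Rightarrow> real" where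
  "cut_xi \<alpha> R p = step (fst p / R powr \<alpha> - 1) * step ((4 * (norm (snd p))\<^sup>2 / R\<^sup>2 - 1) / 3)"

definition cut_chi :: "real \<Rightarrow> ('n::finite) spacetime \<Rightarrow> real" where
  "cut_chi \<tau> p = 1 - step (fst p / \<tau> - 1)"

text \<open>With the exponent \<open>n + 2\<close>, the squared gradient divided by the cutoff still
  carries the factor \<open>cut_xi ^ n\<close>.\<close>

definition cutoff :: "real \<Rightarrow> nat \<Rightarrow> real \<Rightarrow> real \<Rightarrow> ('n::finite) spacetime \<Rightarrow> real" where
  "cutoff \<alpha> n R \<tau> p = cut_xi \<alpha> R p ^ (n + 2) * cut_chi \<tau> p"

text \<open>The region where \<open>cut_xi\<close> descends from 1 to 0.\<close>

definition shell :: "real \<Rightarrow> real \<Rightarrow> ('n::finite) spacetime set" where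
  "shell \<alpha> R = {0..2 * R powr \<alpha>} \<times> cball 0 R - {..R powr \<alpha>} \<times> cball 0 (R / 2)"

lemma cut_xi_bounds: "0 \<le> cut_xi \<alpha> R p" "cut_xi \<alpha> R p \<le> 1"
  using mult_mono[OF step_le_1 step_le_1] step_nonneg by (auto simp: cut_xi_def)

lemma cut_chi_bounds: "0 \<le> cut_chi \<tau> p" "cut_chi \<tau> p \<le> 1"
  using step_nonneg step_le_1 by (auto simp: cut_chi_def)

lemma cutoff_bounds: "0 \<le> cutoff \<alpha> n R \<tau> p" "cutoff \<alpha> n R \<tau> p \<le> 1"
  using mult_le_one[OF power_le_one[OF cut_xi_bounds, of \<alpha> R p "n + 2"] cut_chi_bounds[of \<tau> p]]
    zero_le_power[OF cut_xi_bounds(1), of \<alpha> R p "n + 2"] cut_chi_bounds(1)[of \<tau> p]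
  unfolding cutoff_def by (simp_all only: mult_nonneg_nonneg)

lemma cut_xi_eq_0:
  assumes "R > 0" "fst p > 2 * R powr \<alpha> \<or> norm (snd p) > R"
  shows "cut_xi \<alpha> R p = 0"
  using assms(2)
proof
  assume "fst p > 2 * R powr \<alpha>"
  then have "fst p / R powr \<alpha> - 1 \<ge> 1" using assms(1) by (simp add: field_simps)
  then show ?thesis by (simp add: cut_xi_def step_eq_0)
next
  assume "norm (snd p) > R"
  then have "R\<^sup>2 \<le> (norm (snd p))\<^sup>2" using assms(1) by (intro power_mono) auto
  then have "(4 * (norm (snd p))\<^sup>2 / R\<^sup>2 - 1) / 3 \<ge> 1" using assms(1) by (simp add: field_simps)
  then show ?thesis by (simp add: cut_xi_def step_eq_0)
qed

lemma cutoff_eq_0: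
  assumes "R > 0" "\<tau> > 0" "p \<notin> {\<tau>..2 * R powr \<alpha>} \<times> cball 0 R"
  shows "cutoff \<alpha> n R \<tau> p = 0"
proof (cases "fst p < \<tau>")
  case True
  then have "fst p / \<tau> - 1 \<le> 0" using assms(2) by (simp add: field_simps)
  then show ?thesis by (simp add: cutoff_def cut_chi_def step_eq_1)
next
  case False
  then have "cut_xi \<alpha> R p = 0" using assms by (intro cut_xi_eq_0) (auto simp: mem_Times_iff)
  then show ?thesis by (simp add: cutoff_def)
qed

lemma cutoff_eq_1:
  assumes "R > 0" "\<tau> > 0" "2 * \<tau> \<le> fst p" "fst p \<le> R powr \<alpha>" "norm (snd p) \<le> R / 2"
  shows "cutoff \<alpha> n R \<tau> p = 1"
proof -
  have "fst p / \<tau> - 1 \<ge> 1" "fst p / R powr \<alpha> - 1 \<le> 0" using assms by (simp_all add: field_simps)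
  moreover have "(norm (snd p))\<^sup>2 \<le> (R / 2)\<^sup>2" using assms by (intro power_mono) auto
  then have "(4 * (norm (snd p))\<^sup>2 / R\<^sup>2 - 1) / 3 \<le> 0" using assms(1) by (simp add: field_simps power2_eq_square)
  ultimately show ?thesis by (simp add: cutoff_def cut_xi_def cut_chi_def step_eq_0 step_eq_1)
qed

text \<open>The first derivative is linear in the point, hence smooth.\<close>

lemma smooth_norm_snd_squared:
  "smooth_on UNIV (\<lambda>p :: 'a::euclidean_space \<times> 'b::euclidean_space. (norm (snd p))\<^sup>2)"
  unfolding smooth_on_def
proof
  fix k
  show "C_k_on k UNIV (\<lambda>p :: 'a \<times> 'b. (norm (snd p))\<^sup>2)"
  proof (cases k)
    case 0
    then show ?thesis by (auto intro!: continuous_intros)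
  next
    case (Suc j)
    show ?thesis unfolding Suc
    proof (rule C_k_on_SucI[where f' = "\<lambda>p v. 2 * (snd p \<bullet> snd v)"])
      show "((\<lambda>p :: 'a \<times> 'b. (norm (snd p))\<^sup>2) has_derivative (\<lambda>v. 2 * (snd p \<bullet> snd v))) (at p)" for p
        unfolding power2_norm_eq_inner
        by (auto intro!: derivative_eq_intros simp: inner_commute)
      show "C_k_on j UNIV (\<lambda>p :: 'a \<times> 'b. 2 * (snd p \<bullet> snd v))" for v
        by (rule C_k_on_bounded_linear)
          (auto intro!: bounded_linear_intros bounded_linear_const_mult bounded_linear_inner_left_comp bounded_linear_snd)
    qed simp
  qed
qed

lemma smooth_cut_xi: "smooth_on UNIV (cut_xi \<alpha> R)"
proof -
  have 1: "smooth_on UNIV (\<lambda>p::'a spacetime. inverse (R powr \<alpha>) * fst p - 1)"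
    by (intro smooth_on_diff smooth_on_mult smooth_on_const smooth_on_bounded_linear bounded_linear_fst) auto
  have 2: "smooth_on UNIV (\<lambda>p::'a spacetime. inverse 3 * (4 * inverse (R\<^sup>2) * (norm (snd p))\<^sup>2 - 1))"
    by (intro smooth_on_diff smooth_on_mult[OF _ smooth_on_const] smooth_on_const smooth_norm_snd_squared) auto
  have "smooth_on UNIV (\<lambda>p::'a spacetime. step (inverse (R powr \<alpha>) * fst p - 1) * step (inverse 3 * (4 * inverse (R\<^sup>2) * (norm (snd p))\<^sup>2 - 1)))"
    by (intro smooth_on_mult smooth_on_step 1 2) auto
  then show ?thesis unfolding cut_xi_def[abs_def] by (simp add: field_simps)
qed

lemma smooth_cut_chi: "smooth_on UNIV (cut_chi \<tau>)"
proof -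
  have 1: "smooth_on UNIV (\<lambda>p::'a spacetime. inverse \<tau> * fst p - 1)"
    by (intro smooth_on_diff smooth_on_mult smooth_on_const smooth_on_bounded_linear bounded_linear_fst) auto
  have "smooth_on UNIV (\<lambda>p::'a spacetime. 1 - step (inverse \<tau> * fst p - 1))"
    by (intro smooth_on_diff smooth_on_const smooth_on_step 1) auto
  then show ?thesis unfolding cut_chi_def[abs_def] by (simp add: field_simps)
qed

lemma smooth_cutoff: "smooth_on UNIV (cutoff \<alpha> n R \<tau>)"
  unfolding cutoff_def[abs_def]
  by (intro smooth_on_mult smooth_on_power smooth_cut_xi smooth_cut_chi) auto

lemma dt_grad_cut_xi:
  assumes "R > 0"
  shows "dt (cut_xi \<alpha> R) p = step ((4 * (norm (snd p))\<^sup>2 / R\<^sup>2 - 1) / 3) * step' (fst p / R powr \<alpha> - 1) / R powr \<alpha>"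
    and "grad (cut_xi \<alpha> R) p =
      (step (fst p / R powr \<alpha> - 1) * step' ((4 * (norm (snd p))\<^sup>2 / R\<^sup>2 - 1) / 3) * 8 / (3 * R\<^sup>2)) *\<^sub>R snd p"
proof -
  let ?x = "(4 * (norm (snd p))\<^sup>2 / R\<^sup>2 - 1) / 3" and ?t = "fst p / R powr \<alpha> - 1"
  have 1: "((\<lambda>p. step (fst p / R powr \<alpha> - 1)) has_derivative (\<lambda>v. step' ?t * (fst v / R powr \<alpha>))) (at p)"
    by (rule has_derivative_compose[OF _ DERIV_step[unfolded has_field_derivative_def]])
      (use assms in \<open>auto intro!: derivative_eq_intros\<close>)
  have 2: "((\<lambda>p. step ((4 * (norm (snd p))\<^sup>2 / R\<^sup>2 - 1) / 3)) has_derivative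
      (\<lambda>v. step' ?x * (8 / (3 * R\<^sup>2) * (snd p \<bullet> snd v)))) (at p)"
    by (rule has_derivative_compose[OF _ DERIV_step[unfolded has_field_derivative_def]])
      (use assms in \<open>auto intro!: derivative_eq_intros simp: power2_norm_eq_inner inner_commute field_simps\<close>)
  note h = has_derivative_dt_grad[OF has_derivative_mult[OF 1 2], folded cut_xi_def]
  show "dt (cut_xi \<alpha> R) p = step ?x * step' ?t / R powr \<alpha>" using h(1) by simp
  show "grad (cut_xi \<alpha> R) p = (step ?t * step' ?x * 8 / (3 * R\<^sup>2)) *\<^sub>R snd p"
    using h(2) by (simp add: vec_eq_iff inner_axis)
qed

text \<open>As \<open>step'\<close> is not positive, the time derivative is non-negative: this is
  the favourable sign near the initial time.\<close>

lemma dt_grad_cut_chi: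
  assumes "\<tau> > 0"
  shows "dt (cut_chi \<tau>) p = - step' (fst p / \<tau> - 1) / \<tau>" "grad (cut_chi \<tau>) p = 0"
proof -
  have 1: "((\<lambda>p. step (fst p / \<tau> - 1)) has_derivative (\<lambda>v. step' (fst p / \<tau> - 1) * (fst v / \<tau>))) (at p)"
    by (rule has_derivative_compose[OF _ DERIV_step[unfolded has_field_derivative_def]])
      (use assms in \<open>auto intro!: derivative_eq_intros\<close>)
  note h = has_derivative_dt_grad[OF has_derivative_diff[OF has_derivative_const[of 1] 1], folded cut_chi_def]
  show "dt (cut_chi \<tau>) p = - step' (fst p / \<tau> - 1) / \<tau>" "grad (cut_chi \<tau>) p = 0"
    using h by (simp_all add: vec_eq_iff)
qed

lemma dt_grad_cutoff:
  assumes "R > 0" "\<tau> > 0"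
  shows "dt (cutoff \<alpha> n R \<tau>) p = real (n + 2) * cut_xi \<alpha> R p ^ (n + 1) * cut_chi \<tau> p * dt (cut_xi \<alpha> R) p
      + cut_xi \<alpha> R p ^ (n + 2) * dt (cut_chi \<tau>) p"
    and "grad (cutoff \<alpha> n R \<tau>) p = (real (n + 2) * cut_xi \<alpha> R p ^ (n + 1) * cut_chi \<tau> p) *\<^sub>R grad (cut_xi \<alpha> R) p"
proof -
  have D: "((\<lambda>x. x ^ (n + 2)) has_real_derivative real (n + 2) * x ^ (n + 1)) (at x)" for x
    using DERIV_pow[of "n + 2" x] by simp
  have s: "smooth_on UNIV (\<lambda>p. cut_xi \<alpha> R p ^ (n + 2))"
    by (intro smooth_on_power smooth_cut_xi) simp
  note g = dt_grad_compose[OF smooth_cut_xi _ D, of p]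
  show "dt (cutoff \<alpha> n R \<tau>) p = real (n + 2) * cut_xi \<alpha> R p ^ (n + 1) * cut_chi \<tau> p * dt (cut_xi \<alpha> R) p
      + cut_xi \<alpha> R p ^ (n + 2) * dt (cut_chi \<tau>) p"
    unfolding cutoff_def[abs_def] using dt_grad_mult(1)[OF s smooth_cut_chi, of p] g(1) by simp
  show "grad (cutoff \<alpha> n R \<tau>) p = (real (n + 2) * cut_xi \<alpha> R p ^ (n + 1) * cut_chi \<tau> p) *\<^sub>R grad (cut_xi \<alpha> R) p"
    unfolding cutoff_def[abs_def] using dt_grad_mult(2)[OF s smooth_cut_chi, of p] g(2) dt_grad_cut_chi(2)[OF assms(2), of p]
    by (simp add: mult_ac)
qed

section \<open>The pointwise estimate\<close>

text \<open>The left side is the integrand that remains after integrating by parts in time. It has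
  three contributions: the gradient term, where the negative \<open>psi'\<close> absorbs the energy
  of \<open>s\<close>; the time derivative of \<open>cut_xi\<close>; and that of
  \<open>cut_chi\<close>, which leaves only an approximation error because \<open>F (u p)\<close> is
  non-negative. The constant \<open>C\<close> depends on none of \<open>R\<close>, \<open>e\<close>,
  \<open>\<tau>\<close>.\<close>

lemma integrand_bound:
  fixes u s :: "('n::finite) spacetime \<Rightarrow> real"
  assumes B: "\<And>x. \<bar>step' x\<bar> \<le> B" and q: "q > 1" and d: "0 < d" "1 + d \<le> q"
    and n: "n \<ge> 1" "real (n + 2) * (1 + d) \<le> real n * q"
    and par: "R > 1" "\<tau> > 0" "e > 0" "c > 0"
    and U: "open U" "U \<subseteq> half_space" "p \<in> U" and s: "smooth_on U s" and u: "0 \<le> u p"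
    and ell: "elliptic_at a A p"
    and A: "R / 2 < norm (snd p) \<Longrightarrow> norm (snd p) < R \<Longrightarrow> A p \<le> c * R powr (2 - \<alpha>)"
    and F: "\<And>x. (F has_real_derivative psi d e x) (at x)" "F 0 = 0"
  defines "z \<equiv> cutoff \<alpha> n R \<tau>"
    and "C \<equiv> ((real (n + 2))\<^sup>2 * (4 * 2 powr d / d) * (c * B\<^sup>2 * (64 / 9)) + 2 * real (n + 2) * B) * 2 powr (1 + d)"
  shows "dirichlet a (\<lambda>p. psi d e (s p) * z p) s p - F (s p) * dt z p \<le>
    C * R powr (- \<alpha>) * e * (indicator (shell \<alpha> R) p * (1 + 2 powr q / e powr q * (u p powr q * z p + \<bar>s p - u p\<bar> powr q)))
    + 2 * B / \<tau> * \<bar>s p - u p\<bar>"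
proof -
  define N where "N = real (n + 2)"
  define \<xi> where "\<xi> = cut_xi \<alpha> R p"
  define \<kappa> where "\<kappa> = cut_chi \<tau> p"
  define D where "D = qform a p (grad (cut_xi \<alpha> R) p) (grad (cut_xi \<alpha> R) p)"
  define Z where "Z = (1 + \<bar>s p\<bar> / e) powr (1 + d) * \<xi> ^ n"
  define I where "I = (indicator (shell \<alpha> R) p :: real)"
  have B0: "0 \<le> B" using B[of 0] by (rule order_trans[OF abs_ge_zero])
  have N: "0 \<le> N" by (simp add: N_def)
  have x: "0 \<le> \<xi>" "\<xi> \<le> 1" "0 \<le> \<kappa>" "\<kappa> \<le> 1" "0 \<le> D"
    using cut_xi_bounds[where R = R and p = p and \<alpha> = \<alpha>] cut_chi_bounds[where \<tau> = \<tau> and p = p] elliptic_atD(2)[OF ell] by (auto simp: \<xi>_def \<kappa>_def D_def)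
  have Ra: "R powr \<alpha> > 0" "R powr (- \<alpha>) = 1 / R powr \<alpha>" using par by (auto simp: powr_minus_divide)
  have fp: "0 < fst p" using U by (auto simp: half_space_def)
  have Z0: "0 \<le> Z" using x by (simp add: Z_def)

  \<comment> \<open>Outside the shell the point lies either beyond the outer boundary, where
    \<open>\<xi> = 0\<close>, or in the inner cylinder, where \<open>cut_xi\<close> has vanishing
    derivatives.\<close>
  have inner: "D = 0 \<and> dt (cut_xi \<alpha> R) p = 0 \<or> \<xi> = 0" if "p \<notin> shell \<alpha> R"
  proof (cases "fst p > 2 * R powr \<alpha> \<or> norm (snd p) > R")
    case True
    then show ?thesis using cut_xi_eq_0[where R = R and p = p and \<alpha> = \<alpha>] par by (simp add: \<xi>_def)
  next
    case False
    then have "fst p \<le> R powr \<alpha>" "norm (snd p) \<le> R / 2"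
      using that fp by (auto simp: shell_def mem_Times_iff)
    then have "fst p / R powr \<alpha> - 1 \<le> 0" and sq: "(norm (snd p))\<^sup>2 \<le> (R / 2)\<^sup>2"
      using Ra(1) by (simp, intro power_mono) auto
    moreover from sq have "(4 * (norm (snd p))\<^sup>2 / R\<^sup>2 - 1) / 3 \<le> 0"
      using par by (simp add: field_simps power2_eq_square)
    ultimately show ?thesis
      using par by (simp add: D_def dt_grad_cut_xi step'_eq_0 qform_zero)
  qed
  \<comment> \<open>Where the spatial step varies, the gradient of \<open>cut_xi\<close> is at most
    \<open>8 * B / (3 * R)\<close> and \<open>A p \<le> c * R powr (2 - \<alpha>)\<close>; the
    product has order \<open>R powr (- \<alpha>)\<close>. The factor \<open>\<xi> ^ n\<close>, with
    \<open>n \<ge> 1\<close>, covers the points where only \<open>\<xi> = 0\<close> is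
    known.\<close>
  have DI: "\<xi> ^ n * D \<le> \<xi> ^ n * (c * B\<^sup>2 * (64 / 9) * R powr (- \<alpha>) * I)"
  proof (cases "p \<in> shell \<alpha> R")
    case False
    then show ?thesis using inner n by (auto simp: I_def power_0_left)
  next
    case True
    have "D \<le> c * B\<^sup>2 * (64 / 9) * R powr (- \<alpha>)"
    proof (cases "R / 2 < norm (snd p) \<and> norm (snd p) < R")
      case T: True
      define g where "g = step (fst p / R powr \<alpha> - 1) * step' ((4 * (norm (snd p))\<^sup>2 / R\<^sup>2 - 1) / 3) * 8 / (3 * R\<^sup>2)"
      have "\<bar>g\<bar> = \<bar>step (fst p / R powr \<alpha> - 1)\<bar> * \<bar>step' ((4 * (norm (snd p))\<^sup>2 / R\<^sup>2 - 1) / 3)\<bar> * (8 / (3 * R\<^sup>2))"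
        by (simp add: g_def abs_mult)
      also have "\<dots> \<le> 1 * B * (8 / (3 * R\<^sup>2))"
        using B B0 step_nonneg step_le_1 by (intro mult_right_mono mult_mono) auto
      finally have "\<bar>g\<bar> * norm (snd p) \<le> (B * (8 / (3 * R\<^sup>2))) * R"
        using T B0 by (intro mult_mono) auto
      also have "\<dots> = B * 8 / (3 * R)" using par by (simp add: power2_eq_square)
      finally have "norm (grad (cut_xi \<alpha> R) p) \<le> B * 8 / (3 * R)"
        using dt_grad_cut_xi(2)[where R = R and \<alpha> = \<alpha> and p = p] par by (simp add: g_def)
      then have "(norm (grad (cut_xi \<alpha> R) p))\<^sup>2 \<le> (B * 8 / (3 * R))\<^sup>2" by (intro power_mono) auto
      moreover have "A p \<le> c * R powr (2 - \<alpha>)" using A T by auto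
      ultimately have "A p * (norm (grad (cut_xi \<alpha> R) p))\<^sup>2 \<le> (c * R powr (2 - \<alpha>)) * (B * 8 / (3 * R))\<^sup>2"
        using par by (intro mult_mono) auto
      also have "R powr (2 - \<alpha>) = R\<^sup>2 * R powr (- \<alpha>)"
        using par by (simp add: powr_diff powr_minus_divide)
      also have "c * (R\<^sup>2 * R powr (- \<alpha>)) * (B * 8 / (3 * R))\<^sup>2 = c * B\<^sup>2 * (64 / 9) * R powr (- \<alpha>)"
        using par by (simp add: power2_eq_square field_simps)
      finally show ?thesis using elliptic_atD(3)[OF ell] unfolding D_def by (rule order_trans[rotated])
    next
      case F: False
      have "(4 * (norm (snd p))\<^sup>2 / R\<^sup>2 - 1) / 3 \<le> 0 \<or> (4 * (norm (snd p))\<^sup>2 / R\<^sup>2 - 1) / 3 \<ge> 1"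
      proof (cases "norm (snd p) \<le> R / 2")
        case True
        then have "(norm (snd p))\<^sup>2 \<le> (R / 2)\<^sup>2" by (intro power_mono) auto
        then show ?thesis using par by (simp add: field_simps power2_eq_square)
      next
        case False
        then have "R\<^sup>2 \<le> (norm (snd p))\<^sup>2" using F par by (intro power_mono) auto
        then show ?thesis using par by (simp add: field_simps)
      qed
      then have "D = 0" using par by (simp add: D_def dt_grad_cut_xi step'_eq_0 qform_zero)
      then show ?thesis using par by simp
    qed
    then show ?thesis using True x by (intro mult_left_mono) (auto simp: I_def)
  qed
  have TI: "\<xi> ^ (n + 1) * \<bar>dt (cut_xi \<alpha> R) p\<bar> \<le> \<xi> ^ (n + 1) * (B * R powr (- \<alpha>) * I)"
  proof (cases "p \<in> shell \<alpha> R")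
    case False
    then show ?thesis using inner by (auto simp: I_def)
  next
    case True
    have "\<bar>dt (cut_xi \<alpha> R) p\<bar> = \<bar>step ((4 * (norm (snd p))\<^sup>2 / R\<^sup>2 - 1) / 3)\<bar> * \<bar>step' (fst p / R powr \<alpha> - 1)\<bar> * R powr (- \<alpha>)"
      using par by (simp add: dt_grad_cut_xi abs_mult Ra)
    also have "\<dots> \<le> 1 * B * R powr (- \<alpha>)"
      using B B0 step_nonneg step_le_1 by (intro mult_right_mono mult_mono) auto
    finally show ?thesis using True x by (intro mult_left_mono) (auto simp: I_def)
  qed
  have F_lip: "\<bar>F x - F y\<bar> \<le> 2 * \<bar>x - y\<bar>" for x y
  proof -
    have "norm (F x - F y) \<le> 2 * norm (x - y)"
      by (rule field_differentiable_bound[of UNIV F "psi d e"])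
        (use F(1) psi_bounds[of d e] in \<open>auto simp: abs_of_nonneg[OF order_trans[OF zero_le_one psi_bounds(1)]]\<close>)
    then show ?thesis by simp
  qed
  \<comment> \<open>The non-negativity of \<open>u\<close> enters here: \<open>F\<close> increases
    from \<open>F 0 = 0\<close>.\<close>
  have F_mono: "0 \<le> F (u p)"
  proof -
    have "F 0 \<le> F (u p)"
      by (rule DERIV_nonneg_imp_nondecreasing[OF u])
        (use F(1) psi_bounds(1)[of d e] in \<open>auto intro: order_trans[OF zero_le_one]\<close>)
    then show ?thesis using F(2) by simp
  qed

  \<comment> \<open>The gradient term\<close>
  have zU: "smooth_on U z" unfolding z_def by (rule smooth_on_subset[OF smooth_cutoff]) simp
  define P where "P = - psi' d e (s p)"
  have P: "0 < P" "1 / P \<le> 4 * 2 powr d / d * e * (1 + \<bar>s p\<bar> / e) powr (1 + d)"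
    using psi'_neg[of d e "s p"] inverse_psi'_le[of d e "s p"] d par by (auto simp: P_def)
  define G where "G = qform a p (grad (cut_xi \<alpha> R) p) (grad s p)"
  define H where "H = qform a p (grad s p) (grad s p)"
  define W where "W = psi d e (s p)"
  have W: "0 \<le> W" "W \<le> 2" using psi_bounds[of d e "s p"] by (auto simp: W_def)
  have zp: "z p = \<xi> ^ (n + 2) * \<kappa>" by (simp add: z_def cutoff_def \<xi>_def \<kappa>_def)
  have gp: "grad (\<lambda>p. psi d e (s p) * z p) p = (- z p * P) *\<^sub>R grad s p + (W * (N * \<xi> ^ (n + 1) * \<kappa>)) *\<^sub>R grad (cut_xi \<alpha> R) p"
    using dt_grad_mult(2)[OF smooth_on_psi[OF U(1) s] zU U(3), of d e]
      dt_grad_compose(2)[OF s U(3) DERIV_psi, of e d] par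
      dt_grad_cutoff(2)[where R = R and \<tau> = \<tau> and \<alpha> = \<alpha> and n = n and p = p, folded z_def N_def \<xi>_def \<kappa>_def]
    by (simp add: P_def W_def mult.commute)
  \<comment> \<open>Weights chosen so that, after multiplication by
    \<open>\<xi> ^ n * \<kappa> / P\<close>, the left side is the cross term and the first term on
    the right is exactly \<open>z p * P * H\<close>, which cancels the contribution of
    \<open>psi'\<close>.\<close>
  have "2 * ((P * \<xi>) * (W * N / 2)) * G \<le> (P * \<xi>)\<^sup>2 * H + (W * N / 2)\<^sup>2 * D"
    using qform_young[OF ell, of "P * \<xi>" "W * N / 2" "grad s p" "grad (cut_xi \<alpha> R) p"]
      elliptic_atD(1)[OF ell, of "grad s p" "grad (cut_xi \<alpha> R) p"]
    by (simp add: G_def H_def D_def)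
  also have "\<dots> \<le> (P * \<xi>)\<^sup>2 * H + N\<^sup>2 * D"
  proof -
    have "(W * N / 2)\<^sup>2 \<le> N\<^sup>2" using W N mult_right_mono[OF W(2) N] by (intro power_mono) auto
    then show ?thesis using x by (intro add_left_mono mult_right_mono)
  qed
  finally have "(2 * ((P * \<xi>) * (W * N / 2)) * G) * (\<xi> ^ n * \<kappa> / P) \<le> ((P * \<xi>)\<^sup>2 * H + N\<^sup>2 * D) * (\<xi> ^ n * \<kappa> / P)"
    using x P by (intro mult_right_mono) auto
  moreover have "(2 * ((P * \<xi>) * (W * N / 2)) * G) * (\<xi> ^ n * \<kappa> / P) = W * (N * \<xi> ^ (n + 1) * \<kappa>) * G"
    using P by (simp add: field_simps)
  moreover have "((P * \<xi>)\<^sup>2 * H + N\<^sup>2 * D) * (\<xi> ^ n * \<kappa> / P) = z p * P * H + N\<^sup>2 * \<kappa> * (\<xi> ^ n * D) * (1 / P)"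
    using P by (simp add: zp field_simps power2_eq_square)
  moreover have "dirichlet a (\<lambda>p. psi d e (s p) * z p) s p = - (z p * P * H) + W * (N * \<xi> ^ (n + 1) * \<kappa>) * G"
    by (simp add: dirichlet_eq_qform gp qform_add_left qform_scaleR_left G_def H_def del: scaleR_minus_left)
  ultimately have "dirichlet a (\<lambda>p. psi d e (s p) * z p) s p \<le> N\<^sup>2 * \<kappa> * (\<xi> ^ n * D) * (1 / P)" by linarith
  also have "\<dots> \<le> N\<^sup>2 * \<kappa> * (\<xi> ^ n * (c * B\<^sup>2 * (64 / 9) * R powr (- \<alpha>) * I)) * (4 * 2 powr d / d * e * (1 + \<bar>s p\<bar> / e) powr (1 + d))"
    by (rule mult_mono[OF mult_left_mono[OF DI] P(2)]) (use x P N par in \<open>auto simp: I_def\<close>)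
  also have "\<dots> = (N\<^sup>2 * (4 * 2 powr d / d) * (c * B\<^sup>2 * (64 / 9))) * (e * R powr (- \<alpha>) * I * (\<kappa> * Z))"
    by (simp add: Z_def mult_ac)
  finally have grad_part: "dirichlet a (\<lambda>p. psi d e (s p) * z p) s p \<le>
    (N\<^sup>2 * (4 * 2 powr d / d) * (c * B\<^sup>2 * (64 / 9))) * (e * R powr (- \<alpha>) * I * (\<kappa> * Z))" .

  \<comment> \<open>The time derivative of \<open>cut_xi\<close>\<close>
  have sZ: "\<bar>s p\<bar> * \<xi> ^ (n + 1) \<le> e * Z"
  proof -
    have "\<bar>s p\<bar> / e \<le> (1 + \<bar>s p\<bar> / e) powr 1" using par by simp
    also have "\<dots> \<le> (1 + \<bar>s p\<bar> / e) powr (1 + d)" using par d by (intro powr_mono) auto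
    finally have "\<bar>s p\<bar> / e * \<xi> ^ (n + 1) \<le> (1 + \<bar>s p\<bar> / e) powr (1 + d) * \<xi> ^ n"
      using x par by (intro mult_mono power_decreasing) auto
    then show ?thesis using par by (simp add: Z_def field_simps)
  qed
  \<comment> \<open>\<open>F\<close> is Lipschitz with constant 2 and vanishes at 0;
    \<open>sZ\<close> then produces the same quantity \<open>Z\<close> as in the gradient
    term.\<close>
  have "- F (s p) * (N * \<xi> ^ (n + 1) * \<kappa> * dt (cut_xi \<alpha> R) p) \<le> \<bar>F (s p)\<bar> * (N * \<kappa> * (\<xi> ^ (n + 1) * \<bar>dt (cut_xi \<alpha> R) p\<bar>))"
    by (rule order_trans[OF abs_ge_self]) (use x N in \<open>simp add: abs_mult mult_ac\<close>)
  also have "\<dots> \<le> (2 * \<bar>s p\<bar>) * (N * \<kappa> * (\<xi> ^ (n + 1) * (B * R powr (- \<alpha>) * I)))"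
    by (rule mult_mono[OF _ mult_left_mono[OF TI]]) (use F_lip[of "s p" 0] F(2) x N in auto)
  also have "\<dots> = (2 * N * B) * (\<kappa> * R powr (- \<alpha>) * I) * (\<bar>s p\<bar> * \<xi> ^ (n + 1))" by (simp add: mult_ac)
  also have "\<dots> \<le> (2 * N * B) * (\<kappa> * R powr (- \<alpha>) * I) * (e * Z)"
    by (rule mult_left_mono[OF sZ]) (use x N B0 in \<open>auto simp: I_def\<close>)
  also have "\<dots> = (2 * N * B) * (e * R powr (- \<alpha>) * I * (\<kappa> * Z))" by (simp add: mult_ac)
  finally have time_part: "- F (s p) * (N * \<xi> ^ (n + 1) * \<kappa> * dt (cut_xi \<alpha> R) p) \<le>
    (2 * N * B) * (e * R powr (- \<alpha>) * I * (\<kappa> * Z))" .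

  \<comment> \<open>The time derivative of the cutoff near the initial time\<close>
  define c' where "c' = dt (cut_chi \<tau>) p"
  have c': "0 \<le> c'" "c' \<le> B / \<tau>"
    using step'_nonpos[of "fst p / \<tau> - 1"] B[of "fst p / \<tau> - 1"] par
      divide_right_mono[of "- step' (fst p / \<tau> - 1)" B \<tau>]
    by (auto simp: c'_def dt_grad_cut_chi divide_nonpos_nonneg)
  \<comment> \<open>\<open>F (u p)\<close> may be added since it is non-negative and so is
    \<open>c'\<close>; what remains is a difference of values of \<open>F\<close>.\<close>
  have "- F (s p) * (\<xi> ^ (n + 2) * c') \<le> (2 * \<bar>s p - u p\<bar>) * (\<xi> ^ (n + 2) * c')"
    using F_lip[of "s p" "u p"] F_mono x c' by (intro mult_right_mono) auto
  also have "\<dots> \<le> (2 * \<bar>s p - u p\<bar>) * (1 * (B / \<tau>))"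
    using x c' by (intro mult_left_mono mult_mono power_le_one) auto
  finally have initial_part: "- F (s p) * (\<xi> ^ (n + 2) * c') \<le> 2 * B / \<tau> * \<bar>s p - u p\<bar>" by (simp add: mult_ac)

  \<comment> \<open>Sum of the three contributions\<close>
  have dtz: "dt z p = N * \<xi> ^ (n + 1) * \<kappa> * dt (cut_xi \<alpha> R) p + \<xi> ^ (n + 2) * c'"
    using dt_grad_cutoff(1)[where R = R and \<tau> = \<tau> and \<alpha> = \<alpha> and n = n and p = p, folded z_def N_def \<xi>_def \<kappa>_def c'_def] par by simp
  have "dirichlet a (\<lambda>p. psi d e (s p) * z p) s p - F (s p) * dt z p \<le>
    (N\<^sup>2 * (4 * 2 powr d / d) * (c * B\<^sup>2 * (64 / 9)) + 2 * N * B) * (e * R powr (- \<alpha>) * I * (\<kappa> * Z)) + 2 * B / \<tau> * \<bar>s p - u p\<bar>"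
    using grad_part time_part initial_part unfolding dtz by (simp add: algebra_simps)
  moreover have "\<kappa> * Z \<le> 2 powr (1 + d) * (1 + 2 powr q / e powr q * (u p powr q * z p + \<bar>s p - u p\<bar> powr q))"
  proof -
    \<comment> \<open>The power \<open>1 + d\<close> becomes \<open>q\<close>, so that the bound can
      be expressed by \<open>u powr q\<close> and the \<open>q\<close>-th power of the
      error.\<close>
    have "Z \<le> 2 powr (1 + d) * (1 + (\<bar>s p\<bar> / e) powr q * \<xi> ^ (n + 2))"
      unfolding Z_def using par x d n by (intro weight_young) auto
    then have "\<kappa> * Z \<le> \<kappa> * (2 powr (1 + d) * (1 + (\<bar>s p\<bar> / e) powr q * \<xi> ^ (n + 2)))"
      using x by (intro mult_left_mono)
    also have "\<dots> = 2 powr (1 + d) * (\<kappa> + (\<bar>s p\<bar> / e) powr q * z p)" by (simp add: zp algebra_simps)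
    also have "\<dots> \<le> 2 powr (1 + d) * (1 + 2 powr q / e powr q * (u p powr q * z p + \<bar>s p - u p\<bar> powr q))"
    proof -
      have z: "0 \<le> z p" "z p \<le> 1" using cutoff_bounds[where R = R and \<tau> = \<tau> and \<alpha> = \<alpha> and n = n and p = p] by (auto simp: z_def)
      have "\<bar>s p\<bar> powr q \<le> 2 powr q * (u p powr q + \<bar>s p - u p\<bar> powr q)"
        using powr_abs_add_le[of q "u p" "s p - u p"] q u by simp
      then have "\<bar>s p\<bar> powr q * z p \<le> 2 powr q * (u p powr q + \<bar>s p - u p\<bar> powr q) * z p"
        using z by (intro mult_right_mono)
      also have "\<dots> = 2 powr q * (u p powr q * z p + \<bar>s p - u p\<bar> powr q * z p)" by (simp add: algebra_simps)
      also have "\<dots> \<le> 2 powr q * (u p powr q * z p + \<bar>s p - u p\<bar> powr q)"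
        using z by (intro mult_left_mono add_left_mono mult_left_le) auto
      finally have "\<bar>s p\<bar> powr q * z p / e powr q \<le> 2 powr q * (u p powr q * z p + \<bar>s p - u p\<bar> powr q) / e powr q"
        by (intro divide_right_mono) auto
      then show ?thesis using x par by (intro mult_left_mono add_mono) (auto simp: powr_divide)
    qed
    finally show ?thesis .
  qed
  then have "(N\<^sup>2 * (4 * 2 powr d / d) * (c * B\<^sup>2 * (64 / 9)) + 2 * N * B) * (e * R powr (- \<alpha>) * I * (\<kappa> * Z)) \<le>
    (N\<^sup>2 * (4 * 2 powr d / d) * (c * B\<^sup>2 * (64 / 9)) + 2 * N * B) * (e * R powr (- \<alpha>) * I *
      (2 powr (1 + d) * (1 + 2 powr q / e powr q * (u p powr q * z p + \<bar>s p - u p\<bar> powr q))))"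
    using par d N B0 by (intro mult_left_mono) (auto simp: I_def)
  ultimately show ?thesis unfolding C_def N_def[symmetric] I_def[symmetric] by (simp add: mult_ac)
qed

section \<open>The integral estimate\<close>

text \<open>Lebesgue measure is complete, and the preimages of a set under \<open>f\<close> and
  \<open>g\<close> differ by a null set.\<close>

lemma borel_measurable_lebesgue_AE_cong:
  fixes f g :: "'a::euclidean_space \<Rightarrow> real"
  assumes "g \<in> borel_measurable lebesgue" "AE x in lebesgue. f x = g x"
  shows "f \<in> borel_measurable lebesgue"
proof (rule measurableI)
  fix S :: "real set" assume "S \<in> sets borel"
  then have "g -` S \<inter> space lebesgue \<in> sets lebesgue" by (rule measurable_sets[OF assms(1)])
  then show "f -` S \<inter> space lebesgue \<in> sets lebesgue"
    by (rule completion.in_sets_AE[rotated]) (use assms(2) in \<open>auto elim!: eventually_mono\<close>)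
qed simp

lemma lebesgue_on_support:
  fixes f :: "'a::euclidean_space \<Rightarrow> real"
  assumes "S \<subseteq> T" "S \<in> sets lebesgue" "T \<in> sets lebesgue" "\<And>p. p \<in> T - S \<Longrightarrow> f p = 0"
  shows "(LINT p|lebesgue_on T. f p) = (LINT p|lebesgue_on S. f p)"
    and "integrable (lebesgue_on T) f \<longleftrightarrow> integrable (lebesgue_on S) f"
proof -
  have "indicator T p *\<^sub>R f p = indicator S p *\<^sub>R f p" for p
    using assms(1) assms(4)[of p] by (cases "p \<in> S"; cases "p \<in> T") auto
  then have eq: "(\<lambda>p. indicator T p *\<^sub>R f p) = (\<lambda>p. indicator S p *\<^sub>R f p)" by (rule ext)
  have ST: "S \<inter> space lebesgue \<in> sets lebesgue" "T \<inter> space lebesgue \<in> sets lebesgue" using assms by auto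
  show "(LINT p|lebesgue_on T. f p) = (LINT p|lebesgue_on S. f p)"
    "integrable (lebesgue_on T) f \<longleftrightarrow> integrable (lebesgue_on S) f"
    unfolding integral_restrict_space[OF ST(1)] integral_restrict_space[OF ST(2)]
      integrable_restrict_space[OF ST(1)] integrable_restrict_space[OF ST(2)]
      set_lebesgue_integral_def set_integrable_def eq by (rule refl)+
qed

text \<open>Outside \<open>S\<close> the function is zero up to a null set, so completeness supplies
  its measurability on \<open>T\<close>. This suits limits in \<open>L\<^sup>1\<close>, which are
  determined almost everywhere only.\<close>

lemma lebesgue_on_AE_support:
  fixes f :: "'a::euclidean_space \<Rightarrow> real"
  assumes "S \<subseteq> T" "S \<in> sets lebesgue" "T \<in> sets lebesgue"
    "AE p in lebesgue_on T. p \<notin> S \<longrightarrow> f p = 0" "integrable (lebesgue_on S) f"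
  shows "(LINT p|lebesgue_on T. f p) = (LINT p|lebesgue_on S. f p)"
proof -
  have ST: "S \<inter> space lebesgue \<in> sets lebesgue" "T \<inter> space lebesgue \<in> sets lebesgue" using assms by auto
  have eq: "AE p in lebesgue. indicator T p *\<^sub>R f p = indicator S p *\<^sub>R f p"
  proof -
    have "AE p in lebesgue. p \<in> T \<longrightarrow> p \<notin> S \<longrightarrow> f p = 0"
      using assms(3,4) by (simp add: AE_restrict_space_iff)
    then show ?thesis
      by (rule AE_mp) (use assms(1) in \<open>auto simp: indicator_def\<close>)
  qed
  have m: "(\<lambda>p. indicator S p *\<^sub>R f p) \<in> borel_measurable lebesgue"
    using assms(5) unfolding integrable_restrict_space[OF ST(1)] set_integrable_def by (rule borel_measurable_integrable)
  have "(LINT p|lebesgue. indicator T p *\<^sub>R f p) = (LINT p|lebesgue. indicator S p *\<^sub>R f p)"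
    by (rule integral_cong_AE[OF borel_measurable_lebesgue_AE_cong[OF m eq] m eq])
  then show ?thesis
    unfolding integral_restrict_space[OF ST(1)] integral_restrict_space[OF ST(2)] set_lebesgue_integral_def .
qed

text \<open>Convex bounded domains that exhaust the half-space and carry the approximating
  sequences.\<close>

definition cylinder :: "real \<Rightarrow> ('n::finite) spacetime set" where
  "cylinder M = {0<..<M} \<times> ball 0 M"

lemma open_cylinder: "open (cylinder M)"
  by (simp add: cylinder_def open_Times)

lemma cylinder_subset: "cylinder M \<subseteq> half_space"
  by (auto simp: cylinder_def half_space_def)

lemma bounded_cylinder: "bounded (cylinder M)"
  unfolding cylinder_def by (intro bounded_Times) auto

lemma bounded_domain_cylinder:
  assumes "M > 0" shows "bounded_domain (cylinder M :: ('n::finite) spacetime set)"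
proof -
  have "(M / 2, 0) \<in> (cylinder M :: 'n spacetime set)" using assms by (simp add: cylinder_def)
  moreover have "connected (cylinder M :: 'n spacetime set)"
    unfolding cylinder_def by (intro convex_connected convex_Times) auto
  ultimately show ?thesis
    unfolding bounded_domain_def using open_cylinder cylinder_subset bounded_cylinder by blast
qed

lemma UN_cylinder: "(\<Union>m. cylinder (real (Suc m))) = (half_space :: ('n::finite) spacetime set)"
proof (intro equalityI subsetI)
  fix p :: "'n spacetime" assume p: "p \<in> half_space"
  obtain m where "max (fst p) (norm (snd p)) < real m" using reals_Archimedean2 by blast
  then have "p \<in> cylinder (real (Suc m))"
    using p by (auto simp: cylinder_def half_space_def mem_Times_iff)
  then show "p \<in> (\<Union>m. cylinder (real (Suc m)))" by blast
qed (use cylinder_subset in blast)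

text \<open>Countably many cylinders cover the half-space, and countably many null sets form a null
  set.\<close>

lemma AE_half_space_cylinders:
  assumes "\<And>M. M > 0 \<Longrightarrow> AE p in lebesgue_on (cylinder M). P p"
  shows "AE p in lebesgue_on (half_space :: ('n::finite) spacetime set). P p"
proof -
  have "AE p in lebesgue. \<forall>m. p \<in> (cylinder (real (Suc m)) :: 'n spacetime set) \<longrightarrow> P p"
    unfolding AE_all_countable
    using assms by (auto simp: AE_restrict_space_iff borel_open open_cylinder)
  then have "AE p in lebesgue. p \<in> (half_space :: 'n spacetime set) \<longrightarrow> P p"
    by (rule AE_mp) (auto simp flip: UN_cylinder)
  then show ?thesis by (simp add: AE_restrict_space_iff borel_open open_half_space)
qed

text \<open>A subsequence converges almost everywhere, and on \<open>S\<close> it is constantly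
  zero.\<close>

lemma L1_limit_zero:
  assumes "L1_limit U f F" "\<And>k p. p \<in> S \<Longrightarrow> f k p = 0"
  shows "AE p in lebesgue_on U. p \<in> S \<longrightarrow> F p = 0"
proof -
  have i: "integrable (lebesgue_on U) (\<lambda>p. \<bar>f k p - F p\<bar>)" for k
    using assms(1) by (simp add: L1_limit_def)
  obtain r where r: "strict_mono r" "AE p in lebesgue_on U. (\<lambda>k. f (r k) p - F p) \<longlonglongrightarrow> 0"
    using tendsto_L1_AE_subseq[of "lebesgue_on U" "\<lambda>k p. f k p - F p"] assms(1)
    by (auto simp: L1_limit_def)
  from r(2) show ?thesis
  proof eventually_elim
    case (elim p)
    show ?case
    proof
      assume "p \<in> S"
      then have "(\<lambda>k::nat. - F p) \<longlonglongrightarrow> 0" using elim assms(2) by simp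
      then show "F p = 0" by (simp add: tendsto_const_iff)
    qed
  qed
qed

context elliptic_coeffs
begin

text \<open>Localises the weak inequality. For a test function supported in \<open>K\<close>, the
  same \<open>G\<close> is the limit on every cylinder of integrands vanishing off \<open>K\<close>,
  so it vanishes almost everywhere off \<open>K\<close> and the integral over the half-space reduces
  to one cylinder.\<close>

lemma weak_solution_on_cylinder:
  assumes sol: "entire_weak_solution a q u" and q: "q > 1" and M: "M > 0"
  obtains s ut where "W_represents a q (cylinder M) s u" "L1_limit (cylinder M) (\<lambda>k. dt (s k)) ut"
    "\<And>K \<phi>. compact K \<Longrightarrow> K \<subseteq> cylinder M \<Longrightarrow> test_function \<phi> \<Longrightarrow> (\<And>p. p \<notin> K \<Longrightarrow> \<phi> p = 0) \<Longrightarrow>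
      \<exists>G. L1_limit (cylinder M) (\<lambda>k. dirichlet a \<phi> (s k)) G \<and>
        0 \<le> (LINT p|lebesgue_on (cylinder M). ut p * \<phi> p + G p - \<bar>u p\<bar> powr (q - 1) * u p * \<phi> p)"
proof -
  obtain \<sigma> ut where rep: "W_loc_represents a q \<sigma> u"
    and ut: "\<And>\<Omega>. bounded_domain \<Omega> \<Longrightarrow> L1_limit \<Omega> (\<lambda>k. dt (\<sigma> \<Omega> k)) ut"
    and weak: "\<And>\<phi>. test_function \<phi> \<Longrightarrow>
           \<exists>G. (\<forall>\<Omega>. bounded_domain \<Omega> \<longrightarrow> L1_limit \<Omega> (\<lambda>k. dirichlet a \<phi> (\<sigma> \<Omega> k)) G) \<and>
             (LINT p|lebesgue_on half_space.
                ut p * \<phi> p + G p - \<bar>u p\<bar> powr (q - 1) * u p * \<phi> p) \<ge> 0"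
    using sol unfolding entire_weak_solution_def by blast
  let ?U = "cylinder M :: 'n spacetime set"
  have dom: "bounded_domain ?U" by (rule bounded_domain_cylinder[OF M])
  have repU: "W_represents a q ?U (\<sigma> ?U) u" using rep dom unfolding W_loc_represents_def by blast
  show thesis
  proof (rule that[OF repU ut[OF dom]])
    fix K \<phi> assume K: "compact K" "K \<subseteq> ?U" and \<phi>: "test_function \<phi>" and \<phi>0: "\<And>p. p \<notin> K \<Longrightarrow> \<phi> p = 0"
    obtain G where G: "\<And>\<Omega>. bounded_domain \<Omega> \<Longrightarrow> L1_limit \<Omega> (\<lambda>k. dirichlet a \<phi> (\<sigma> \<Omega> k)) G"
      "(LINT p|lebesgue_on half_space. ut p * \<phi> p + G p - \<bar>u p\<bar> powr (q - 1) * u p * \<phi> p) \<ge> 0"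
      using weak[OF \<phi>] by blast
    have "grad \<phi> p = 0" if "p \<in> - K" for p
      by (rule dt_grad_zero(2)[of "- K"]) (use that K \<phi>0 in \<open>auto simp: compact_imp_closed\<close>)
    then have D0: "dirichlet a \<phi> w p = 0" if "p \<in> - K" for w p
      using that by (simp add: dirichlet_eq_qform qform_zero)
    have "AE p in lebesgue_on half_space. p \<in> - K \<longrightarrow> G p = 0"
      by (rule AE_half_space_cylinders) (rule L1_limit_zero[OF G(1)[OF bounded_domain_cylinder] D0])
    then have "AE p in lebesgue_on half_space. p \<notin> ?U \<longrightarrow> ut p * \<phi> p + G p - \<bar>u p\<bar> powr (q - 1) * u p * \<phi> p = 0"
    proof eventually_elim
      case (elim p)
      show ?case using elim K \<phi>0[of p] by (cases "p \<in> K") auto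
    qed
    moreover have "integrable (lebesgue_on ?U) (\<lambda>p. ut p * \<phi> p + G p - \<bar>u p\<bar> powr (q - 1) * u p * \<phi> p)"
    proof -
      have s\<phi>: "smooth_on half_space \<phi>" using \<phi> by (simp add: test_function_def)
      have "bounded (\<phi> ` K)"
        using K cylinder_subset smooth_on_continuous[OF s\<phi>]
        by (intro compact_imp_bounded compact_continuous_image) (auto intro: continuous_on_subset)
      then obtain b where b: "b > 0" "\<And>p. p \<in> K \<Longrightarrow> \<bar>\<phi> p\<bar> \<le> b" unfolding bounded_pos by auto
      have "\<bar>\<phi> p\<bar> \<le> b" for p using b \<phi>0[of p] by (cases "p \<in> K") auto
      then have bA: "AE p in lebesgue_on ?U. \<bar>\<phi> p\<bar> \<le> b" by simp
      have \<phi>m: "\<phi> \<in> borel_measurable (lebesgue_on ?U)"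
        by (rule measurable_smooth(1)[OF open_cylinder smooth_on_subset[OF s\<phi> cylinder_subset]])
      have "integrable (lebesgue_on ?U) ut" "integrable (lebesgue_on ?U) G"
        using ut[OF dom] G(1)[OF dom] by (auto simp: L1_limit_def)
      moreover have "integrable (lebesgue_on ?U) (\<lambda>p. \<bar>u p\<bar> powr (q - 1) * u p)"
        using W_represents_integrable[OF repU q] by simp
      ultimately show ?thesis
        by (intro Bochner_Integration.integrable_add Bochner_Integration.integrable_diff
            integrable_mult_bounded[OF _ \<phi>m bA])
    qed
    ultimately have "(LINT p|lebesgue_on half_space. ut p * \<phi> p + G p - \<bar>u p\<bar> powr (q - 1) * u p * \<phi> p)
       = (LINT p|lebesgue_on ?U. ut p * \<phi> p + G p - \<bar>u p\<bar> powr (q - 1) * u p * \<phi> p)"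
      by (intro lebesgue_on_AE_support cylinder_subset) (simp_all add: borel_open open_cylinder open_half_space)
    then show "\<exists>G. L1_limit ?U (\<lambda>k. dirichlet a \<phi> (\<sigma> ?U k)) G \<and>
        0 \<le> (LINT p|lebesgue_on ?U. ut p * \<phi> p + G p - \<bar>u p\<bar> powr (q - 1) * u p * \<phi> p)"
      using G dom by (intro exI[of _ G]) auto
  qed
qed

text \<open>Test with \<open>psi d e (s k) * z\<close>, integrate by parts in time, apply the
  pointwise bound and let the approximation error vanish. The coefficient
  \<open>2 * B / \<tau>\<close> multiplies only that error, so the right side involves
  \<open>\<tau>\<close> through \<open>z\<close> alone.\<close>

lemma cutoff_estimate:
  assumes sol: "entire_weak_solution a q u" and u0: "AE p in lebesgue_on half_space. 0 \<le> u p"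
    and B: "\<And>x. \<bar>step' x\<bar> \<le> B" and q: "q > 1" and d: "0 < d" "1 + d \<le> q"
    and n: "n \<ge> 1" "real (n + 2) * (1 + d) \<le> real n * q"
    and par: "R > 1" "\<tau> > 0" "e > 0" "c > 0"
    and A: "AE p in lebesgue_on half_space. R / 2 < norm (snd p) \<longrightarrow> norm (snd p) < R \<longrightarrow> A p \<le> c * R powr (2 - \<alpha>)"
  defines "z \<equiv> cutoff \<alpha> n R \<tau>"
    and "C \<equiv> ((real (n + 2))\<^sup>2 * (4 * 2 powr d / d) * (c * B\<^sup>2 * (64 / 9)) + 2 * real (n + 2) * B) * 2 powr (1 + d)"
    and "S \<equiv> indicator (shell \<alpha> R) :: 'n spacetime \<Rightarrow> real"
  shows "integrable (lebesgue_on half_space) (\<lambda>p. \<bar>u p\<bar> powr q * z p)"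
    and "(LINT p|lebesgue_on half_space. \<bar>u p\<bar> powr q * z p) \<le> C * R powr (- \<alpha>) * e *
      (measure lebesgue ({0..2 * R powr \<alpha>} \<times> cball (0 :: real ^ 'n) R)
        + 2 powr q / e powr q * (LINT p|lebesgue_on half_space. S p * (\<bar>u p\<bar> powr q * z p)))"
proof -
  have [simp]: "qhat q = q" using q by (simp add: qhat_def)
  \<comment> \<open>The summand 1 places the closed support of the cutoff inside the open
    cylinder.\<close>
  define M where "M = max (2 * R powr \<alpha>) R + 1"
  have M: "M > 0" "2 * R powr \<alpha> < M" "R < M" using par by (auto simp: M_def)
  define U where "U = (cylinder M :: 'n spacetime set)"
  define K where "K = {\<tau>..2 * R powr \<alpha>} \<times> cball (0 :: real ^ 'n) R"
  have U: "open U" "U \<subseteq> half_space" "bounded U"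
    unfolding U_def by (rule open_cylinder cylinder_subset bounded_cylinder)+
  have UL: "U \<in> sets lebesgue" "half_space \<in> sets (lebesgue :: 'n spacetime measure)"
    using U(1) by (simp_all add: borel_open open_half_space)
  have K: "compact K" "K \<subseteq> U" "\<And>p. p \<notin> K \<Longrightarrow> z p = 0"
    unfolding K_def U_def cylinder_def z_def using M par
    by (auto intro!: compact_Times cutoff_eq_0)
  obtain s ut where rep: "W_represents a q U s u" and ut: "L1_limit U (\<lambda>k. dt (s k)) ut"
    and weak: "\<And>K \<phi>. compact K \<Longrightarrow> K \<subseteq> U \<Longrightarrow> test_function \<phi> \<Longrightarrow> (\<And>p. p \<notin> K \<Longrightarrow> \<phi> p = 0) \<Longrightarrow>
      \<exists>G. L1_limit U (\<lambda>k. dirichlet a \<phi> (s k)) G \<and>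
        0 \<le> (LINT p|lebesgue_on U. ut p * \<phi> p + G p - \<bar>u p\<bar> powr (q - 1) * u p * \<phi> p)"
    using weak_solution_on_cylinder[OF sol q M(1)] unfolding U_def by blast
  have sm: "smooth_on U (s k)" for k using rep by (auto simp: W_represents_def W_smooth_def)
  have um: "u \<in> borel_measurable (lebesgue_on U)"
    and iqd: "integrable (lebesgue_on U) (\<lambda>p. \<bar>s k p - u p\<bar> powr q)"
    and Lq: "(\<lambda>k. LINT p|lebesgue_on U. \<bar>s k p - u p\<bar> powr q) \<longlonglongrightarrow> 0" for k
    using rep by (auto simp: W_represents_def)
  have zs: "smooth_on UNIV z" "\<And>p. 0 \<le> z p" "\<And>p. z p \<le> 1"
    unfolding z_def by (rule smooth_cutoff cutoff_bounds)+
  have zm: "z \<in> borel_measurable (lebesgue_on U)"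
    by (rule measurable_smooth(1)[OF U(1)]) (rule smooth_on_subset[OF zs(1)], simp)
  have iuz: "integrable (lebesgue_on U) (\<lambda>p. \<bar>u p\<bar> powr q * z p)"
  proof (rule integrable_mult_bounded[OF _ zm])
    have "\<bar>u p\<bar> powr q = \<bar>\<bar>u p\<bar> powr (q - 1) * u p\<bar>" for p
      by (cases "u p = 0") (auto simp: abs_mult powr_diff)
    then show "integrable (lebesgue_on U) (\<lambda>p. \<bar>u p\<bar> powr q)"
      using integrable_abs[OF W_represents_integrable[OF rep q]] by simp
    show "AE p in lebesgue_on U. \<bar>z p\<bar> \<le> 1" using zs by simp
  qed
  have zU: "\<bar>u p\<bar> powr q * z p = 0" if "p \<in> half_space - U" for p
    using K(2) K(3)[of p] that by auto
  show "integrable (lebesgue_on half_space) (\<lambda>p. \<bar>u p\<bar> powr q * z p)"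
    using lebesgue_on_support(2)[OF U(2) UL zU] iuz by simp
  have Sb: "shell \<alpha> R \<in> sets (borel :: 'n spacetime measure)"
    unfolding shell_def by (intro sets.Diff borel_closed closed_Times) auto
  then have Sm: "S \<in> borel_measurable (lebesgue_on U)"
    unfolding S_def by (intro measurable_restrict_space1 borel_measurable_indicator) simp
  have iSz: "integrable (lebesgue_on U) (\<lambda>p. S p * (\<bar>u p\<bar> powr q * z p))"
    using integrable_mult_bounded[OF iuz Sm, of 1] by (simp add: S_def mult.commute)
  define L where "L = (LINT p|lebesgue_on half_space. S p * (\<bar>u p\<bar> powr q * z p))"
  have L: "L = (LINT p|lebesgue_on U. S p * (\<bar>u p\<bar> powr q * z p))"
    unfolding L_def using zU by (intro lebesgue_on_support(1)[OF U(2) UL]) auto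
  interpret fU: finite_measure "lebesgue_on U" by (rule finite_measure_lebesgue_on_bounded[OF U(1,3)])
  have iS: "integrable (lebesgue_on U) S"
    using integrable_mult_bounded[OF fU.integrable_const[of 1] Sm, of 1] by (simp add: S_def)
  define V where "V = measure lebesgue ({0..2 * R powr \<alpha>} \<times> cball (0 :: real ^ 'n) R)"
  have SV: "(LINT p|lebesgue_on U. S p) \<le> V"
  proof -
    have Q: "compact ({0..2 * R powr \<alpha>} \<times> cball (0 :: real ^ 'n) R)" by (intro compact_Times) auto
    have "(LINT p|lebesgue_on U. S p) = measure lebesgue (shell \<alpha> R \<inter> U)"
      using Sb UL unfolding S_def by (simp add: measure_restrict_space sets_restrict_space)
    also have "\<dots> \<le> V" unfolding V_def
    proof (rule measure_mono_fmeasurable)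
      show "shell \<alpha> R \<inter> U \<in> sets lebesgue" using Sb UL by (intro sets.Int) auto
      show "{0..2 * R powr \<alpha>} \<times> cball (0 :: real ^ 'n) R \<in> lmeasurable" by (rule lmeasurable_compact[OF Q])
    qed (auto simp: shell_def)
    finally show ?thesis .
  qed
  obtain F where F: "\<And>x. (F has_real_derivative psi d e x) (at x)" "F 0 = 0"
    using antiderivative_UNIV[of "psi d e"] DERIV_isCont[OF DERIV_psi] par by blast
  define W where "W = measure (lebesgue_on U) U"
  have B0: "0 \<le> B" using B[of 0] by (rule order_trans[OF abs_ge_zero])
  have C0: "0 \<le> C" unfolding C_def using d par B0 by simp
  define a1 where "a1 = C * R powr (- \<alpha>) * e"
  define a2 where "a2 = a1 * (2 powr q / e powr q)"
  have a1: "0 \<le> a1" "0 \<le> a2" using C0 par by (auto simp: a1_def a2_def)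
  define g where "g = 2 * B / \<tau>"
  have g: "0 \<le> g" using B0 par by (simp add: g_def)
  \<comment> \<open>One \<open>\<eta>\<close> comes from the weak inequality, one from the constant
    \<open>b\<close>, one from the \<open>L\<^sup>q\<close> distance of \<open>s k\<close> to
    \<open>u\<close>.\<close>
  have main: "(LINT p|lebesgue_on U. \<bar>u p\<bar> powr q * z p) \<le> a1 * V + a2 * L + 3 * \<eta>" if \<eta>: "\<eta> > 0" for \<eta>
  proof -
    define \<phi> where "\<phi> = (\<lambda>k p. psi d e (s k p) * z p)"
    \<comment> \<open>Splitting level for the error \<open>g * \<bar>s k p - u p\<bar>\<close>: its
      constant part integrates to \<open>g * b * W \<le> \<eta>\<close>, the rest joins the
      \<open>q\<close>-th powers collected in \<open>a4\<close>.\<close>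
    define b where "b = \<eta> / (1 + g * W)"
    have "0 \<le> g * W" using g by (simp add: W_def)
    then have b: "b > 0" "g * b * W \<le> \<eta>" using \<eta> by (auto simp: b_def field_simps)
    define a4 where "a4 = a2 + g * b powr (1 - q)"
    have a4: "0 \<le> a4" using a1 g by (simp add: a4_def)
    obtain N where N: "\<And>k. k \<ge> N \<Longrightarrow>
      integrable (lebesgue_on U) (dirichlet a (\<phi> k) (s k)) \<and>
      integrable (lebesgue_on U) (\<lambda>p. dt (s k) p * \<phi> k p) \<and>
      integrable (lebesgue_on U) (\<lambda>p. \<bar>u p\<bar> powr (q - 1) * u p * \<phi> k p) \<and>
      (LINT p|lebesgue_on U. \<bar>u p\<bar> powr (q - 1) * u p * \<phi> k p) \<le>
        (LINT p|lebesgue_on U. dt (s k) p * \<phi> k p) + (LINT p|lebesgue_on U. dirichlet a (\<phi> k) (s k) p) + \<eta>"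
      using weak_test_limit[OF U q rep ut weak[OF K(1,2)] zs K d(1) par(3) \<eta>] unfolding \<phi>_def by blast
    have "(\<lambda>k. a4 * (LINT p|lebesgue_on U. \<bar>s k p - u p\<bar> powr q)) \<longlonglongrightarrow> a4 * 0"
      by (intro tendsto_mult Lq tendsto_const)
    then have "\<forall>\<^sub>F k in sequentially. a4 * (LINT p|lebesgue_on U. \<bar>s k p - u p\<bar> powr q) < \<eta>"
      using \<eta> by (intro order_tendstoD(2)) auto
    then obtain k where k: "k \<ge> N" "a4 * (LINT p|lebesgue_on U. \<bar>s k p - u p\<bar> powr q) < \<eta>"
      unfolding eventually_sequentially by (metis nle_le)
    note Nk = N[OF k(1)]
    have AEU: "AE p in lebesgue_on U. 0 \<le> u p"
      by (rule AE_lebesgue_on_subset[OF u0 U(2) UL])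
    have AEA: "AE p in lebesgue_on U. R / 2 < norm (snd p) \<longrightarrow> norm (snd p) < R \<longrightarrow> A p \<le> c * R powr (2 - \<alpha>)"
      by (rule AE_lebesgue_on_subset[OF A U(2) UL])
    have eqF: "(LINT p|lebesgue_on U. dt (s k) p * \<phi> k p) = - (LINT p|lebesgue_on U. F (s k p) * dt z p)"
      and iF: "integrable (lebesgue_on U) (\<lambda>p. F (s k p) * dt z p)"
    proof -
      have "continuous_on UNIV (psi d e)"
        by (rule continuous_at_imp_continuous_on) (use DERIV_isCont[OF DERIV_psi] par in blast)
      note w = weak_time_derivative[OF U(1) sm[of k] zs(1) K F(1) this]
      have eq: "psi d e (s k p) * dt (s k) p * z p = dt (s k) p * \<phi> k p" for p by (simp add: \<phi>_def)
      have i1: "integrable (lebesgue_on U) (\<lambda>p. dt (s k) p * \<phi> k p)" using Nk by blast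
      from Bochner_Integration.integrable_diff[OF w(1) i1]
      show i2: "integrable (lebesgue_on U) (\<lambda>p. F (s k p) * dt z p)" by (simp add: eq)
      have "(LINT p|lebesgue_on U. dt (s k) p * \<phi> k p) + (LINT p|lebesgue_on U. F (s k p) * dt z p) = 0"
        using w(2) Bochner_Integration.integral_add[OF i1 i2] by (simp add: eq)
      then show "(LINT p|lebesgue_on U. dt (s k) p * \<phi> k p) = - (LINT p|lebesgue_on U. F (s k p) * dt z p)" by simp
    qed
    \<comment> \<open>The lower bound \<open>psi \<ge> 1\<close> removes the weight from the left
      side.\<close>
    have "(LINT p|lebesgue_on U. \<bar>u p\<bar> powr q * z p) \<le> (LINT p|lebesgue_on U. \<bar>u p\<bar> powr (q - 1) * u p * \<phi> k p)"
    proof (rule integral_mono_AE)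
      show "AE p in lebesgue_on U. \<bar>u p\<bar> powr q * z p \<le> \<bar>u p\<bar> powr (q - 1) * u p * \<phi> k p"
        using AEU
      proof eventually_elim
        case (elim p)
        have "u p powr (q - 1) * u p = u p powr q"
          using elim by (cases "u p = 0") (auto simp: powr_diff)
        moreover have "z p * 1 \<le> z p * psi d e (s k p)"
          using zs(2) psi_bounds(1) by (rule mult_left_mono[rotated])
        then have "u p powr q * z p \<le> u p powr q * \<phi> k p"
          by (intro mult_left_mono) (auto simp: \<phi>_def mult.commute)
        ultimately show ?case using elim by simp
      qed
    qed (use iuz Nk in auto)
    also have "\<dots> \<le> (LINT p|lebesgue_on U. dt (s k) p * \<phi> k p) + (LINT p|lebesgue_on U. dirichlet a (\<phi> k) (s k) p) + \<eta>"
      using Nk by blast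
    also note eqF
    also have "- (LINT p|lebesgue_on U. F (s k p) * dt z p) + (LINT p|lebesgue_on U. dirichlet a (\<phi> k) (s k) p)
      = (LINT p|lebesgue_on U. dirichlet a (\<phi> k) (s k) p - F (s k p) * dt z p)"
      using Nk iF by simp
    also have "\<dots> \<le> (LINT p|lebesgue_on U. a1 * S p + a2 * (S p * (\<bar>u p\<bar> powr q * z p)) + g * b + a4 * \<bar>s k p - u p\<bar> powr q)"
    proof (rule integral_mono_AE)
      show "AE p in lebesgue_on U. dirichlet a (\<phi> k) (s k) p - F (s k p) * dt z p \<le>
          a1 * S p + a2 * (S p * (\<bar>u p\<bar> powr q * z p)) + g * b + a4 * \<bar>s k p - u p\<bar> powr q"
        using elliptic_on[OF U(1,2)] AEU AEA
      proof eventually_elim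
        case (elim p)
        have "dirichlet a (\<phi> k) (s k) p - F (s k p) * dt z p \<le>
          a1 * (S p * (1 + 2 powr q / e powr q * (u p powr q * z p + \<bar>s k p - u p\<bar> powr q))) + g * \<bar>s k p - u p\<bar>"
          unfolding \<phi>_def z_def a1_def C_def S_def g_def
          by (rule integrand_bound[OF B q d n par U(1,2) _ sm _ _ _ F]) (use elim in auto)
        also have "a1 * (S p * (1 + 2 powr q / e powr q * (u p powr q * z p + \<bar>s k p - u p\<bar> powr q)))
          = a1 * S p + a2 * (S p * (\<bar>u p\<bar> powr q * z p)) + a2 * (S p * \<bar>s k p - u p\<bar> powr q)"
          using elim by (simp add: a2_def algebra_simps)
        also have "a2 * (S p * \<bar>s k p - u p\<bar> powr q) \<le> a2 * (1 * \<bar>s k p - u p\<bar> powr q)"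
          using a1 by (intro mult_left_mono mult_right_mono) (auto simp: S_def indicator_def)
        also have "g * \<bar>s k p - u p\<bar> \<le> g * (b + b powr (1 - q) * \<bar>s k p - u p\<bar> powr q)"
          using g abs_le_small_plus_powr[OF q b(1)] by (intro mult_left_mono)
        finally show ?case by (simp add: a4_def algebra_simps)
      qed
    qed (use Nk iF iS iSz iqd fU.integrable_const in auto)
    also have "\<dots> = a1 * (LINT p|lebesgue_on U. S p) + a2 * L + g * b * W + a4 * (LINT p|lebesgue_on U. \<bar>s k p - u p\<bar> powr q)"
      using iS iSz iqd fU.integrable_const by (simp add: L W_def)
    also have "\<dots> \<le> a1 * V + a2 * L + \<eta> + \<eta>"
      using mult_left_mono[OF SV a1(1)] b k(2) by linarith
    finally show ?thesis by simp
  qed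
  have "(LINT p|lebesgue_on U. \<bar>u p\<bar> powr q * z p) \<le> a1 * V + a2 * L"
  proof (rule field_le_epsilon)
    fix \<eta> :: real assume "\<eta> > 0"
    then show "(LINT p|lebesgue_on U. \<bar>u p\<bar> powr q * z p) \<le> a1 * V + a2 * L + \<eta>"
      using main[of "\<eta> / 3"] by simp
  qed
  also have "(LINT p|lebesgue_on U. \<bar>u p\<bar> powr q * z p) = (LINT p|lebesgue_on half_space. \<bar>u p\<bar> powr q * z p)"
    using lebesgue_on_support(1)[OF U(2) UL zU] by simp
  finally show "(LINT p|lebesgue_on half_space. \<bar>u p\<bar> powr q * z p) \<le> C * R powr (- \<alpha>) * e *
      (measure lebesgue ({0..2 * R powr \<alpha>} \<times> cball (0 :: real ^ 'n) R)
        + 2 powr q / e powr q * (LINT p|lebesgue_on half_space. S p * (\<bar>u p\<bar> powr q * z p)))"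
    by (simp add: a1_def a2_def V_def L_def algebra_simps)
qed

end

section \<open>Vanishing of the solution\<close>

lemma measure_box_times_cball:
  assumes "0 \<le> t" "0 \<le> R"
  shows "measure lebesgue ({0..t} \<times> cball (0 :: real ^ 'n::finite) R) =
    t * (unit_ball_vol (real CARD('n)) * R ^ CARD('n))"
proof -
  have "{0..t} \<times> cball (0 :: real ^ 'n) R \<in> sets borel"
    by (intro borel_closed closed_Times) auto
  then have "measure lebesgue ({0..t} \<times> cball (0 :: real ^ 'n) R) =
      measure (lborel \<Otimes>\<^sub>M lborel) ({0..t} \<times> cball (0 :: real ^ 'n) R)"
    by (simp add: lborel_prod)
  also have "\<dots> = measure lborel {0..t} * measure lborel (cball (0 :: real ^ 'n) R)"
    unfolding measure_def by (subst lborel.emeasure_pair_measure_Times) (auto simp: enn2real_mult)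
  finally show ?thesis using assms by (simp add: content_cball)
qed

text \<open>The plateaus of the cutoffs exhaust the half-space, as the radius tends to infinity and
  the initial layer shrinks to time 0. A point on a plateau lies in the hole of the shell.\<close>

lemma tendsto_eventually_cutoff:
  fixes p :: "('n::finite) spacetime"
  assumes "p \<in> half_space" "\<alpha> > 0"
  shows "\<forall>\<^sub>F j in sequentially. cutoff \<alpha> n (real j + 2) (1 / (real j + 1)) p = 1 \<and> p \<notin> shell \<alpha> (real j + 2)"
proof -
  have t: "0 < fst p" using assms(1) by (auto simp: half_space_def)
  have "\<forall>\<^sub>F j in sequentially. Max {fst p powr (1 / \<alpha>), 2 * norm (snd p), 2 / fst p} \<le> real j"
    using filterlim_real_sequentially unfolding filterlim_at_top by blast
  then show ?thesis
  proof eventually_elim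
    case (elim j)
    then have j: "fst p powr (1 / \<alpha>) \<le> real j" "2 * norm (snd p) \<le> real j" "2 / fst p \<le> real j" by auto
    have "fst p = (fst p powr (1 / \<alpha>)) powr \<alpha>" using t assms(2) by (simp add: powr_powr)
    also have "\<dots> \<le> (real j + 2) powr \<alpha>" using j assms(2) by (intro powr_mono2) auto
    finally have 1: "fst p \<le> (real j + 2) powr \<alpha>" .
    have 2: "norm (snd p) \<le> (real j + 2) / 2" using j(2) by simp
    have "2 * (1 / (real j + 1)) \<le> fst p" using j(3) t by (simp add: field_simps)
    then show ?case
      using cutoff_eq_1[of "real j + 2" "1 / (real j + 1)" p \<alpha> n] 1 2 by (auto simp: shell_def mem_Times_iff)
  qed
qed

theorem theorem6:
  fixes \<alpha> q :: real
    and a :: "('n::finite) coeffs"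
    and A :: "'n spacetime \<Rightarrow> real"
    and u0 :: "real ^ 'n \<Rightarrow> real"
    and u :: "'n spacetime \<Rightarrow> real"
  assumes "\<alpha> > 0"
    and "1 < q" and "q \<le> 1 + \<alpha> / real CARD('n)"
    and "\<And>i j. a i j \<in> borel_measurable (lebesgue_on half_space)"
    and "\<And>i j. locally_bounded_on half_space (a i j)"
    and "\<And>i j. AE p in lebesgue_on half_space. a i j p = a j i p"
    and "A \<in> borel_measurable (lebesgue_on half_space)"
    and "locally_bounded_on half_space A"
    and "\<And>p. p \<in> half_space \<Longrightarrow> 0 \<le> A p"
    and "AE p in lebesgue_on half_space. \<forall>\<xi>::real ^ 'n.
           0 \<le> (\<Sum>i\<in>UNIV. \<Sum>j\<in>UNIV. a i j p * \<xi> $ i * \<xi> $ j) \<and>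
           (\<Sum>i\<in>UNIV. \<Sum>j\<in>UNIV. a i j p * \<xi> $ i * \<xi> $ j) \<le> A p * (norm \<xi>)\<^sup>2"
    and "\<exists>c>0. \<forall>R>1.
           esssup (lebesgue_on ({0<..} \<times> {x::real ^ 'n. R / 2 < norm x \<and> norm x < R}))
             (\<lambda>p. ereal (A p)) \<le> ereal (c * R powr (2 - \<alpha>))"
    and "entire_weak_solution_Cauchy a q u0 u"
    and "AE p in lebesgue_on half_space. 0 \<le> u p"
  shows "AE p in lebesgue_on half_space. u p = 0"
proof -

  \<comment> \<open>Hypotheses in working form and choice of the constants\<close>
  interpret elliptic_coeffs a A
  proof
    have "AE p in lebesgue_on half_space. \<forall>i j. a i j p = a j i p"
      unfolding AE_all_countable using assms(6) by blast
    then show "AE p in lebesgue_on half_space. elliptic_at a A p"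
      using assms(10) by eventually_elim (simp add: elliptic_at_def qform_def)
  qed (use assms in auto)
  have sol: "entire_weak_solution a q u" using assms(12) by (simp add: entire_weak_solution_Cauchy_def)
  then have um: "u \<in> borel_measurable (lebesgue_on half_space)" by (simp add: entire_weak_solution_def)
  note q = assms(2) and u0 = assms(13)
  obtain c where c: "c > 0" and esup: "\<And>R. R > 1 \<Longrightarrow>
      esssup (lebesgue_on ({0<..} \<times> {x::real ^ 'n. R / 2 < norm x \<and> norm x < R})) (\<lambda>p. ereal (A p)) \<le> ereal (c * R powr (2 - \<alpha>))"
    using assms(11) by blast
  have A: "AE p in lebesgue_on half_space. R / 2 < norm (snd p) \<longrightarrow> norm (snd p) < R \<longrightarrow> A p \<le> c * R powr (2 - \<alpha>)"
    if "R > 1" for R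
  proof -
    let ?H = "{0::real<..} \<times> {x::real ^ 'n. R / 2 < norm x \<and> norm x < R}"
    have "open {x::real ^ 'n. R / 2 < norm x \<and> norm x < R}"
      by (intro open_Collect_conj open_Collect_less continuous_intros)
    then have H: "?H \<in> sets lebesgue" by (simp add: borel_open open_Times)
    have "AE p in lebesgue_on ?H. ereal (A p) \<le> ereal (c * R powr (2 - \<alpha>))"
      using esssup_AE[of "\<lambda>p. ereal (A p)" "lebesgue_on ?H"]
      by eventually_elim (rule order_trans[OF _ esup[OF that]])
    then have "AE p in lebesgue. p \<in> ?H \<longrightarrow> A p \<le> c * R powr (2 - \<alpha>)"
      using H by (simp add: AE_restrict_space_iff)
    then have "AE p in lebesgue. p \<in> half_space \<longrightarrow> R / 2 < norm (snd p) \<longrightarrow> norm (snd p) < R \<longrightarrow> A p \<le> c * R powr (2 - \<alpha>)"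
      by (rule AE_mp) (auto simp: half_space_def)
    then show ?thesis by (simp add: AE_restrict_space_iff borel_open open_half_space)
  qed
  obtain B where B: "\<And>x. \<bar>step' x\<bar> \<le> B" "B > 0" using step'_bounded by blast
  \<comment> \<open>This puts \<open>1 + d\<close> midway between 1 and \<open>q\<close>.\<close>
  define d where "d = (q - 1) / 2"
  have d: "0 < d" "1 + d \<le> q" "1 + d < q" using q by (auto simp: d_def field_simps)
  \<comment> \<open>The condition \<open>(n + 2) * (1 + d) \<le> n * q\<close> solved for
    \<open>n\<close>; the added 1 ensures \<open>n \<ge> 1\<close>.\<close>
  define n where "n = nat \<lceil>2 * (1 + d) / (q - (1 + d))\<rceil> + 1"
  have "2 * (1 + d) / (q - (1 + d)) \<le> real n" unfolding n_def by linarith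
  then have n: "n \<ge> 1" "real (n + 2) * (1 + d) \<le> real n * q"
    using d by (auto simp: n_def field_simps)
  define C where "C = ((real (n + 2))\<^sup>2 * (4 * 2 powr d / d) * (c * B\<^sup>2 * (64 / 9)) + 2 * real (n + 2) * B) * 2 powr (1 + d)"
  define v where "v = unit_ball_vol (real CARD('n))"
  have C0: "0 \<le> C" unfolding C_def using d c B(2) by simp
  have v0: "0 \<le> v" unfolding v_def by simp
  define w where "w = (\<lambda>p. \<bar>u p\<bar> powr q)"
  have wm: "w \<in> borel_measurable (lebesgue_on half_space)" unfolding w_def using um by measurable
  define R where "R j = real j + 2" for j :: nat
  define \<tau> where "\<tau> j = 1 / (real j + 1)" for j :: nat
  define z where "z j = (cutoff \<alpha> n (R j) (\<tau> j) :: 'n spacetime \<Rightarrow> real)" for j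
  define S where "S j = (indicator (shell \<alpha> (R j)) :: 'n spacetime \<Rightarrow> real)" for j
  define X where "X j = (LINT p|lebesgue_on half_space. w p * z j p)" for j
  define Y where "Y j = (LINT p|lebesgue_on half_space. S j p * (w p * z j p))" for j
  have par: "R j > 1" "\<tau> j > 0" for j by (auto simp: R_def \<tau>_def)
  have z01: "0 \<le> z j p" "z j p \<le> 1" for j p unfolding z_def by (rule cutoff_bounds)+
  have w0: "0 \<le> w p" for p by (simp add: w_def)
  have wz: "w p * z j p \<le> w p" for j p using mult_left_mono[OF z01(2) w0] by simp
  have Sm: "S j \<in> borel_measurable (lebesgue_on half_space)" for j
  proof -
    have "shell \<alpha> (R j) \<in> sets (borel :: 'n spacetime measure)"
      unfolding shell_def by (intro sets.Diff borel_closed closed_Times) auto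
    then show ?thesis unfolding S_def by (intro measurable_restrict_space1 borel_measurable_indicator) simp
  qed
  have iX: "integrable (lebesgue_on half_space) (\<lambda>p. w p * z j p)" for j
    unfolding w_def z_def by (rule cutoff_estimate(1)[OF sol u0 B(1) q d(1,2) n par zero_less_one c A[OF par(1)]])

  text \<open>The regularisation parameter is \<open>l\<close> times the natural size \<open>R powr (- \<alpha> / (q - 1))\<close> of a
    solution on the scale \<open>R\<close>; the volume term then stays bounded because \<open>q \<le> 1 + \<alpha> / n\<close>.\<close>
  define C1 where "C1 = 2 * C * v + C * 2 powr q"
  have key: "X j \<le> C1 * (l + l powr (1 - q) * Y j)" if l: "l > 0" for j l
  proof -
    define \<beta> where "\<beta> = \<alpha> / (q - 1)"
    define e where "e = l * R j powr (- \<beta>)"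
    have Rp: "R j > 0" "R j \<ge> 1" using par(1)[of j] by auto
    have e: "e > 0" using l Rp by (simp add: e_def)
    have Y0: "0 \<le> Y j" unfolding Y_def by (intro Bochner_Integration.integral_nonneg) (simp add: S_def w0 z01)
    have "X j \<le> C * R j powr (- \<alpha>) * e * (2 * R j powr \<alpha> * (v * R j ^ CARD('n)) + 2 powr q / e powr q * Y j)"
      using cutoff_estimate(2)[OF sol u0 B(1) q d(1,2) n par e c A[OF par(1)], of j j] par(1)[of j]
      unfolding X_def Y_def w_def z_def S_def C_def v_def
      by (simp add: measure_box_times_cball)
    also have "\<dots> = 2 * C * v * (R j powr (- \<alpha>) * R j powr \<alpha>) * (e * R j ^ CARD('n)) + C * 2 powr q * (R j powr (- \<alpha>) * (e / e powr q)) * Y j"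
      by (simp add: algebra_simps)
    also have "R j powr (- \<alpha>) * R j powr \<alpha> = 1" using Rp by (simp flip: powr_add)
    also have "e * R j ^ CARD('n) = l * R j powr (real CARD('n) - \<beta>)"
      using Rp by (simp add: e_def powr_diff powr_minus_divide powr_realpow)
    also have "e / e powr q = e powr (1 - q)" using e by (simp add: powr_diff)
    also have "R j powr (- \<alpha>) * e powr (1 - q) = l powr (1 - q)"
    proof -
      \<comment> \<open>This identity dictates the exponent in \<open>e\<close>: all powers of
        \<open>R j\<close> cancel in the shell term.\<close>
      have "- \<beta> * (1 - q) = \<alpha>" using q by (simp add: \<beta>_def field_simps)
      then have "e powr (1 - q) = l powr (1 - q) * R j powr \<alpha>"
        using l Rp by (simp add: e_def powr_mult powr_powr)
      then show ?thesis using Rp by (simp add: powr_minus_divide)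
    qed
    also have "2 * C * v * 1 * (l * R j powr (real CARD('n) - \<beta>)) + C * 2 powr q * l powr (1 - q) * Y j
        \<le> 2 * C * v * 1 * (l * 1) + C * 2 powr q * l powr (1 - q) * Y j"
    proof -
      \<comment> \<open>The upper bound on \<open>q\<close>, solved for the dimension.\<close>
      have "real CARD('n) \<le> \<beta>" using assms(3) q by (simp add: \<beta>_def field_simps)
      then have "R j powr (real CARD('n) - \<beta>) \<le> R j powr 0" using Rp by (intro powr_mono) auto
      then have "R j powr (real CARD('n) - \<beta>) \<le> 1" using Rp by simp
      then show ?thesis using C0 v0 l by (intro add_right_mono mult_left_mono) auto
    qed
    also have "\<dots> \<le> C1 * (l + l powr (1 - q) * Y j)"
      using C0 v0 l Y0 by (simp add: C1_def algebra_simps)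
    finally show ?thesis .
  qed

  \<comment> \<open>Integrability of the power of the solution\<close>
  have C1: "0 \<le> C1" using C0 v0 by (simp add: C1_def)
  have YX: "Y j \<le> X j" for j
    unfolding X_def Y_def
  proof (rule integral_mono)
    show "integrable (lebesgue_on half_space) (\<lambda>p. S j p * (w p * z j p))"
      using integrable_mult_bounded[OF iX[of j] Sm[of j], of 1] by (simp add: S_def mult.commute)
  qed (use iX w0 z01 in \<open>auto simp: S_def indicator_def\<close>)
  \<comment> \<open>Solves \<open>l0 powr (1 - q) = 1 / (2 * C1 + 1)\<close>. The shell term is then
    at most half of \<open>X j\<close>, which is finite, and can be absorbed on the left.\<close>
  define l0 where "l0 = (2 * C1 + 1) powr (1 / (q - 1))"
  have l0: "l0 > 0" "C1 * l0 powr (1 - q) \<le> 1 / 2"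
  proof -
    have "1 / (q - 1) * (1 - q) = - 1" using q by (simp add: field_simps)
    then have "l0 powr (1 - q) = (2 * C1 + 1) powr (- 1)" by (simp only: l0_def powr_powr)
    also have "\<dots> = 1 / (2 * C1 + 1)" using C1 by (simp add: powr_minus_divide)
    finally have eq: "l0 powr (1 - q) = 1 / (2 * C1 + 1)" .
    show "C1 * l0 powr (1 - q) \<le> 1 / 2" unfolding eq using C1 by (simp add: field_simps)
  qed (use C1 in \<open>simp add: l0_def\<close>)
  have Xb: "X j \<le> 2 * C1 * l0" for j
  proof -
    have "0 \<le> X j" unfolding X_def using w0 z01 by (intro Bochner_Integration.integral_nonneg) simp
    have "X j \<le> C1 * l0 + (C1 * l0 powr (1 - q)) * Y j" using key[OF l0(1), of j] by (simp add: algebra_simps)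
    also have "(C1 * l0 powr (1 - q)) * Y j \<le> (C1 * l0 powr (1 - q)) * X j"
      using YX C1 by (intro mult_left_mono) auto
    also have "\<dots> \<le> 1 / 2 * X j" using l0(2) \<open>0 \<le> X j\<close> by (intro mult_right_mono)
    finally show ?thesis by simp
  qed
  have ev: "\<forall>\<^sub>F j in sequentially. z j p = 1 \<and> S j p = 0" if "p \<in> half_space" for p
    using tendsto_eventually_cutoff[OF that assms(1), of n]
    by eventually_elim (simp add: z_def S_def R_def \<tau>_def)
  \<comment> \<open>Fatou's lemma: at each point \<open>w p * z j p\<close> is eventually equal to
    \<open>w p\<close>, and the integrals \<open>X j\<close> are bounded.\<close>
  have iw: "integrable (lebesgue_on half_space) w"
  proof (rule integrableI_nonneg[OF wm])
    have "(\<integral>\<^sup>+ p. ennreal (w p) \<partial>lebesgue_on half_space) = (\<integral>\<^sup>+ p. liminf (\<lambda>j. ennreal (w p * z j p)) \<partial>lebesgue_on half_space)"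
    proof (rule nn_integral_cong)
      fix p :: "'n spacetime" assume "p \<in> space (lebesgue_on half_space)"
      then have "p \<in> half_space" by simp
      from ev[OF this] have "\<forall>\<^sub>F j in sequentially. ennreal (w p * z j p) = ennreal (w p)"
        by eventually_elim simp
      then have "(\<lambda>j. ennreal (w p * z j p)) \<longlonglongrightarrow> ennreal (w p)" by (rule tendsto_eventually)
      then show "ennreal (w p) = liminf (\<lambda>j. ennreal (w p * z j p))" by (simp add: lim_imp_Liminf)
    qed
    also have "\<dots> \<le> liminf (\<lambda>j. \<integral>\<^sup>+ p. ennreal (w p * z j p) \<partial>lebesgue_on half_space)"
      using iX by (intro nn_integral_liminf) (auto dest: borel_measurable_integrable)
    also have "\<dots> = liminf (\<lambda>j. ennreal (X j))"
      unfolding X_def using iX w0 z01 by (simp add: nn_integral_eq_integral)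
    also have "\<dots> \<le> liminf (\<lambda>j::nat. ennreal (2 * C1 * l0))"
      using Xb by (intro Liminf_mono always_eventually allI ennreal_leI) blast
    also have "\<dots> < \<infinity>" by (simp add: Liminf_const)
    finally show "(\<integral>\<^sup>+ p. ennreal (w p) \<partial>lebesgue_on half_space) < \<infinity>" .
  qed (use w0 in simp)

  \<comment> \<open>Limits as the scale tends to infinity\<close>
  have X_lim: "X \<longlonglongrightarrow> (LINT p|lebesgue_on half_space. w p)"
    unfolding X_def[abs_def]
  proof (rule integral_dominated_convergence[where w = w])
    show "AE p in lebesgue_on half_space. (\<lambda>j. w p * z j p) \<longlonglongrightarrow> w p"
      using AE_space
    proof eventually_elim
      case (elim p)
      then have "p \<in> half_space" by simp
      from ev[OF this] have "\<forall>\<^sub>F j in sequentially. w p * z j p = w p" by eventually_elim simp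
      then show ?case by (rule tendsto_eventually)
    qed
  qed (use iw iX wm w0 z01 wz in \<open>auto dest: borel_measurable_integrable\<close>)
  \<comment> \<open>Every point eventually leaves the shell, and \<open>w\<close> is an integrable
    majorant.\<close>
  have Y_lim: "Y \<longlonglongrightarrow> (LINT p|lebesgue_on (half_space :: 'n spacetime set). 0)"
    unfolding Y_def[abs_def]
  proof (rule integral_dominated_convergence[where w = w])
    show "AE p in lebesgue_on half_space. (\<lambda>j. S j p * (w p * z j p)) \<longlonglongrightarrow> 0"
      using AE_space
    proof eventually_elim
      case (elim p)
      then have "p \<in> half_space" by simp
      from ev[OF this] have "\<forall>\<^sub>F j in sequentially. S j p * (w p * z j p) = 0" by eventually_elim simp
      then show ?case by (rule tendsto_eventually)
    qed
    show "(\<lambda>p. S j p * (w p * z j p)) \<in> borel_measurable (lebesgue_on half_space)" for j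
      using Sm iX[THEN borel_measurable_integrable] by measurable
    show "AE p in lebesgue_on half_space. norm (S j p * (w p * z j p)) \<le> w p" for j
      using w0 z01 wz by (intro AE_I2) (simp add: S_def indicator_def)
  qed (use iw in auto)
  \<comment> \<open>\<open>l\<close> stays fixed until \<open>Y j\<close> has tended to 0; only then
    may \<open>l\<close> become small, since \<open>l powr (1 - q)\<close> is unbounded as
    \<open>l\<close> tends to 0.\<close>
  have le: "(LINT p|lebesgue_on half_space. w p) \<le> C1 * l" if l: "l > 0" for l
  proof -
    have "(\<lambda>j. C1 * (l + l powr (1 - q) * Y j)) \<longlonglongrightarrow> C1 * (l + l powr (1 - q) * 0)"
      using Y_lim by (intro tendsto_intros) simp
    from LIMSEQ_le[OF X_lim this] key[OF l] show ?thesis by simp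
  qed
  have "(LINT p|lebesgue_on half_space. w p) \<le> 0"
  proof (rule field_le_epsilon)
    fix \<eta> :: real assume "\<eta> > 0"
    \<comment> \<open>The added 1 covers the case \<open>C1 = 0\<close>.\<close>
    then have "C1 * (\<eta> / (C1 + 1)) \<le> \<eta>" using C1 by (simp add: field_simps)
    then show "(LINT p|lebesgue_on half_space. w p) \<le> 0 + \<eta>"
      using le[of "\<eta> / (C1 + 1)"] C1 \<open>\<eta> > 0\<close> by (simp add: add_nonneg_pos)
  qed
  then have "(LINT p|lebesgue_on half_space. w p) = 0"
    using w0 by (intro antisym Bochner_Integration.integral_nonneg) auto
  then have "AE p in lebesgue_on half_space. w p = 0"
    using Bochner_Integration.integral_nonneg_eq_0_iff_AE[OF iw] w0 by simp
  then show ?thesis by eventually_elim (simp add: w_def)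
qed

end
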